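(* Let $\mathbb{F}$ be a field of characteristic zero and let $\chi:S_n\to\mathbb{C}^\times$ be a character. Any depth-$4$ occur-$k$ formula that computes $\mathrm{Imm}_\chi(M)$, for $M=(x_{ij})_{n\times n}$ a matrix of distinct variables, must have size $s=2^{\Omega(n/k^2)}$, even when each $\times\curlywedge$ gate is counted as having size one.
   Context: The immanant of $M=(x_{ij})_{n\times n}$ with respect to a character $\chi:S_n\to\mathbb{C}^\times$ is $\mathrm{Imm}_\chi(M)=\sum_{\sigma\in S_n}\chi(\sigma)\prod_{i=1}^n x_{i\sigma(i)}$ (determinant and permanent are special cases). An occur-$k$ formula is a rooted tree whose internal gates are labelled $+$ or $\times\curlywedge$ (power-product gate). A $\times\curlywedge$ gate with inputs $g_1,\ldots,g_m$ along incoming edges labelled $e_1,\ldots,e_m\in\mathbb{N}$ computes $g_1^{e_1}\cdots g_m^{e_m}$; a $+$ gate computes the sum of its inputs. The leaves are depth-$2$ formulas computing sparse polynomials (sums of monomials), called leaf nodes, and every variable occurs in at most $k$ of these leaf polynomials. The size of a $\times\curlywedge$ gate is $e_1+\cdots+e_m$, the size of a $+$ gate is $1$, the size of a leaf node is the size of its depth-$2$ formula; the size of the formula is the total size of all gates and leaf nodes plus the number of edges. The depth is the number of layers of $+$ and $\times\curlywedge$ gates plus $2$. *)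

theory Defs
  imports Complex_Main "HOL-Library.Poly_Mapping" "HOL-Combinatorics.Permutations"
    "Jordan_Normal_Form.Matrix"
begin

section \<open>Multivariate polynomials\<close>

text \<open>Exponent vectors are finitely supported maps from variables to \<open>nat\<close>; polynomials are
  finitely supported maps from exponent vectors to coefficients. Multiplication is the convolution
  product of the library.\<close>

type_synonym 'v monomial = "'v \<Rightarrow>\<^sub>0 nat"
type_synonym ('v, 'a) mpoly = "'v monomial \<Rightarrow>\<^sub>0 'a"

definition Const :: "'a::zero \<Rightarrow> ('v, 'a) mpoly" where
  "Const c = Poly_Mapping.single 0 c"

definition Var :: "'v \<Rightarrow> ('v, 'a::zero_neq_one) mpoly" where
  "Var v = Poly_Mapping.single (Poly_Mapping.single v 1) 1"

definition vars :: "('v, 'a::zero) mpoly \<Rightarrow> 'v set" where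
  "vars p = (\<Union>m\<in>Poly_Mapping.keys p. Poly_Mapping.keys m)"

definition monomial_degree :: "'v monomial \<Rightarrow> nat" where
  "monomial_degree m = (\<Sum>v\<in>Poly_Mapping.keys m. Poly_Mapping.lookup m v)"

section \<open>Characters of the symmetric group and immanants\<close>

text \<open>\<open>S\<^sub>n\<close> acts on \<open>{0,\<dots>,n-1}\<close>, so that matrix indices start at \<open>0\<close>.\<close>

definition Sym :: "nat \<Rightarrow> (nat \<Rightarrow> nat) set" where
  "Sym n = {\<sigma>. \<sigma> permutes {..<n}}"

definition is_representation :: "nat \<Rightarrow> nat \<Rightarrow> ((nat \<Rightarrow> nat) \<Rightarrow> complex mat) \<Rightarrow> bool" where
  "is_representation n d \<rho> \<longleftrightarrow>
     (\<forall>\<sigma>\<in>Sym n. \<rho> \<sigma> \<in> carrier_mat d d) \<and> \<rho> id = 1\<^sub>m d \<and>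
     (\<forall>\<sigma>\<in>Sym n. \<forall>\<tau>\<in>Sym n. \<rho> (\<sigma> \<circ> \<tau>) = \<rho> \<sigma> * \<rho> \<tau>)"

definition is_character :: "nat \<Rightarrow> ((nat \<Rightarrow> nat) \<Rightarrow> complex) \<Rightarrow> bool" where
  "is_character n \<chi> \<longleftrightarrow>
     (\<exists>d \<rho>. is_representation n d \<rho> \<and> (\<forall>\<sigma>\<in>Sym n. \<chi> \<sigma> = (\<Sum>i<d. \<rho> \<sigma> $$ (i, i))))"

text \<open>A character \<open>S\<^sub>n \<rightarrow> \<complex>\<^sup>\<times>\<close> is a character none of whose values is zero. Those of degree one are
  the homomorphisms into the multiplicative group:\<close>

definition is_unit_character :: "nat \<Rightarrow> ((nat \<Rightarrow> nat) \<Rightarrow> complex) \<Rightarrow> bool" where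
  "is_unit_character n \<chi> \<longleftrightarrow> is_character n \<chi> \<and> (\<forall>\<sigma>\<in>Sym n. \<chi> \<sigma> \<noteq> 0)"

lemma multiplicative_is_unit_character:
  assumes hom: "\<And>\<sigma> \<tau>. \<sigma> \<in> Sym n \<Longrightarrow> \<tau> \<in> Sym n \<Longrightarrow> \<chi> (\<sigma> \<circ> \<tau>) = \<chi> \<sigma> * \<chi> \<tau>"
    and nz: "\<And>\<sigma>. \<sigma> \<in> Sym n \<Longrightarrow> \<chi> \<sigma> \<noteq> 0"
  shows "is_unit_character n \<chi>"
proof -
  have id: "id \<in> Sym n" by (simp add: Sym_def permutes_id)
  have "\<chi> id = \<chi> id * \<chi> id" using hom[OF id id] by simp
  hence "\<chi> id = 1" using nz[OF id] by simp
  hence "is_representation n 1 (\<lambda>\<sigma>. mat 1 1 (\<lambda>_. \<chi> \<sigma>))"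
    by (auto simp: is_representation_def hom scalar_prod_def intro!: eq_matI)
  hence "is_character n \<chi>"
    unfolding is_character_def by (intro exI[of _ 1] exI conjI) auto
  thus ?thesis using nz by (simp add: is_unit_character_def)
qed

text \<open>The values of a character are complex numbers, whereas the immanant is a polynomial over
  \<open>F\<close>; to make sense of it, \<open>F\<close> must be an extension, along some \<open>\<phi>\<close>, of a subfield \<open>K\<close> of
  \<open>\<complex>\<close> that contains the values. This puts no restriction on \<open>F\<close> or on the character: characters
  of symmetric groups are integer-valued, so one may always take \<open>K = \<rat>\<close>, and every embedding
  agrees with the canonical one on \<open>\<rat>\<close>.\<close>

definition field_embedding :: "complex set \<Rightarrow> (complex \<Rightarrow> 'a::field) \<Rightarrow> bool" where
  "field_embedding K \<phi> \<longleftrightarrow>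
     0 \<in> K \<and> 1 \<in> K \<and>
     (\<forall>x\<in>K. - x \<in> K \<and> inverse x \<in> K) \<and>
     (\<forall>x\<in>K. \<forall>y\<in>K. x + y \<in> K \<and> x * y \<in> K) \<and>
     \<phi> 1 = 1 \<and>
     (\<forall>x\<in>K. \<forall>y\<in>K. \<phi> (x + y) = \<phi> x + \<phi> y \<and> \<phi> (x * y) = \<phi> x * \<phi> y)"

lemma field_embedding_Rats:
  "field_embedding \<rat> (\<lambda>z. of_rat (THE q. z = of_rat q) :: 'a::field_char_0)"
proof -
  have "(THE q. (of_rat r :: complex) = of_rat q) = r" for r by auto
  note the = this this[of 1, simplified]
  show ?thesis
    unfolding field_embedding_def
    by (auto elim!: Rats_cases simp: the of_rat_add[symmetric] of_rat_mult[symmetric])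
qed

definition immanant ::
    "nat \<Rightarrow> ((nat \<Rightarrow> nat) \<Rightarrow> 'r) \<Rightarrow> (nat \<Rightarrow> nat \<Rightarrow> 'r) \<Rightarrow> 'r::comm_semiring_1" where
  "immanant n \<chi> M = (\<Sum>\<sigma>\<in>Sym n. \<chi> \<sigma> * (\<Prod>i<n. M i (\<sigma> i)))"

definition generic_immanant ::
    "nat \<Rightarrow> ((nat \<Rightarrow> nat) \<Rightarrow> complex) \<Rightarrow> (complex \<Rightarrow> 'a::field) \<Rightarrow> (nat \<times> nat, 'a) mpoly" where
  "generic_immanant n \<chi> \<phi> = immanant n (\<lambda>\<sigma>. Const (\<phi> (\<chi> \<sigma>))) (\<lambda>i j. Var (i, j))"

section \<open>Occur-\<open>k\<close> formulas\<close>

text \<open>A leaf node is a depth-2 (sum of monomials) formula, given by its list of terms: a coefficient,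
  which labels an edge into the sum gate, and the exponent vector of a monomial.\<close>

type_synonym ('v, 'a) depth2 = "('a \<times> 'v monomial) list"

datatype ('v, 'a) formula =
    Leaf "('v, 'a) depth2"
  | SumGate "('v, 'a) formula list"
  | PowerProductGate "(('v, 'a) formula \<times> nat) list"

definition depth2_poly :: "('v, 'a::comm_ring_1) depth2 \<Rightarrow> ('v, 'a) mpoly" where
  "depth2_poly ts = (\<Sum>(c, m)\<leftarrow>ts. Poly_Mapping.single m c)"

fun computes :: "('v, 'a::comm_ring_1) formula \<Rightarrow> ('v, 'a) mpoly" where
  "computes (Leaf ts) = depth2_poly ts"
| "computes (SumGate gs) = (\<Sum>g\<leftarrow>gs. computes g)"
| "computes (PowerProductGate gs) = (\<Prod>(g, e)\<leftarrow>gs. computes g ^ e)"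

fun leaves :: "('v, 'a) formula \<Rightarrow> ('v, 'a) depth2 list" where
  "leaves (Leaf ts) = [ts]"
| "leaves (SumGate gs) = concat (map leaves gs)"
| "leaves (PowerProductGate gs) = concat (map (\<lambda>(g, e). leaves g) gs)"

definition occur :: "nat \<Rightarrow> ('v, 'a::comm_ring_1) formula \<Rightarrow> bool" where
  "occur k \<Phi> \<longleftrightarrow> (\<forall>v. length (filter (\<lambda>ts. v \<in> vars (depth2_poly ts)) (leaves \<Phi>)) \<le> k)"

fun gate_layers :: "('v, 'a) formula \<Rightarrow> nat" where
  "gate_layers (Leaf ts) = 0"
| "gate_layers (SumGate gs) = Suc (Max (insert 0 (gate_layers ` set gs)))"
| "gate_layers (PowerProductGate gs) = Suc (Max (insert 0 ((\<lambda>(g, e). gate_layers g) ` set gs)))"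

definition depth :: "('v, 'a) formula \<Rightarrow> nat" where
  "depth \<Phi> = gate_layers \<Phi> + 2"

text \<open>Gates and edges of a leaf node: the sum gate, and for each term an edge, a product gate and
  one edge per variable of the monomial, counted with multiplicity.\<close>

definition depth2_size :: "('v, 'a) depth2 \<Rightarrow> nat" where
  "depth2_size ts = 1 + (\<Sum>(c, m)\<leftarrow>ts. 2 + monomial_degree m)"

text \<open>\<open>w\<close> assigns a size to a power-product gate, depending on its list of edge labels. The
  summand \<open>length gs\<close> counts the edges entering the gate.\<close>

fun weighted_size :: "(nat list \<Rightarrow> nat) \<Rightarrow> ('v, 'a) formula \<Rightarrow> nat" where
  "weighted_size w (Leaf ts) = depth2_size ts"
| "weighted_size w (SumGate gs) = 1 + length gs + (\<Sum>g\<leftarrow>gs. weighted_size w g)"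
| "weighted_size w (PowerProductGate gs) =
     w (map snd gs) + length gs + (\<Sum>(g, e)\<leftarrow>gs. weighted_size w g)"

definition formula_size :: "('v, 'a) formula \<Rightarrow> nat" where
  "formula_size = weighted_size sum_list"

text \<open>The size when every power-product gate is counted as having size one. It can exceed
  \<open>formula_size\<close> if labels are \<open>0\<close>.\<close>

definition formula_size_unit :: "('v, 'a) formula \<Rightarrow> nat" where
  "formula_size_unit = weighted_size (\<lambda>_. 1)"

end

theory Submission
  imports Defs "Jordan_Normal_Form.Determinant"
begin

text \<open>Flattening the formula writes the immanant \<open>f\<close> as a sum of products of powers of polynomials with
  at most \<open>s\<close> monomials, each variable occurring in at most \<open>k\<close> of them. Differentiating by one
  variable leaves at most \<open>k\<close> products. The derivatives of the \<open>i\<close>-th product by \<open>k + 1\<close> diagonal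
  variables \<open>x\<^sub>j\<close> are, up to a factor common to all \<open>j\<close>, sparse polynomials \<open>B\<^sub>i\<^sub>j\<close>. The matrix \<open>B\<close>
  has fewer rows than columns, hence a kernel vector \<open>(p\<^sub>j)\<close> made of minors of \<open>B\<close>, with at most \<open>s\<^bsup>O(k\<^sup>2)\<^esup>\<close> monomials, and it gives a relation
  \<open>\<Sum>\<^sub>j p\<^sub>j M\<^sub>j = 0\<close> between the minors \<open>M\<^sub>j = \<partial>\<^sub>x \<partial>\<^sub>j f\<close>.

  Such relations have \<open>2\<^bsup>n - O(k)\<^esup>\<close> monomials, whatever the nonzero coefficients of the \<open>M\<^sub>j\<close>. If the
  exponents of the variables in some row not belonging to an \<open>x\<^sub>j\<close> vary over the monomials of
  the \<open>p\<^sub>j\<close>, two initial forms for suitable gradings of this row have disjoint supports, and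
  both are relations between minors with one row and one column less; columns are treated
  likewise. If nothing varies, all monomials of the \<open>p\<^sub>j\<close> agree outside the block of special rows and
  columns, and a permutation avoiding this block gives a monomial of the relation that
  nothing cancels.\<close>

section \<open>Relations between minors\<close>

text \<open>Bijections from rows to columns, kept as edge sets: deleting or inserting an edge
  changes the index sets without renumbering, and transposition is
  \<open>image prod.swap\<close>.\<close>

definition matchings :: "'b set \<Rightarrow> 'b set \<Rightarrow> ('b \<times> 'b) set set" where
  "matchings X Y =
     {E. E \<subseteq> X \<times> Y \<and> (\<forall>r\<in>X. \<exists>!c. (r, c) \<in> E) \<and> (\<forall>c\<in>Y. \<exists>!r. (r, c) \<in> E)}"

lemma finite_matchings: "finite X \<Longrightarrow> finite Y \<Longrightarrow> finite (matchings X Y)"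
  by (rule finite_subset[of _ "Pow (X \<times> Y)"]) (auto simp: matchings_def)

lemma matchings_subset: "E \<in> matchings X Y \<Longrightarrow> E \<subseteq> X \<times> Y"
  by (simp add: matchings_def)

lemma matchings_fst: "E \<in> matchings X Y \<Longrightarrow> fst ` E = X"
  unfolding matchings_def by force

lemma matchings_card:
  assumes "E \<in> matchings X Y"
  shows "card E = card X"
proof -
  have "inj_on fst E"
    using assms unfolding matchings_def inj_on_def by (auto; blast)
  thus ?thesis using card_image matchings_fst[OF assms] by metis
qed

lemma matchings_row:
  assumes "E \<in> matchings X Y" "r \<in> X"
  obtains c where "c \<in> Y" "(r, c) \<in> E" "\<And>c'. (r, c') \<in> E \<Longrightarrow> c' = c"
  using assms unfolding matchings_def by blast

lemma matchings_swap: "E \<in> matchings X Y \<Longrightarrow> prod.swap ` E \<in> matchings Y X"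
proof -
  assume E: "E \<in> matchings X Y"
  have "(c, r) \<in> prod.swap ` E \<longleftrightarrow> (r, c) \<in> E" for r c
    by (metis image_eqI image_iff swap_simp swap_swap)
  thus "prod.swap ` E \<in> matchings Y X" using E unfolding matchings_def by auto
qed

lemma bij_betw_matchings_swap: "bij_betw (image prod.swap) (matchings Y X) (matchings X Y)"
  by (rule bij_betw_byWitness[where f' = "image prod.swap"])
     (auto simp: image_image matchings_swap)

lemma matchings_remove:
  assumes E: "E \<in> matchings X Y" and rc: "(r, c) \<in> E"
  shows "E - {(r, c)} \<in> matchings (X - {r}) (Y - {c})"
proof -
  have sub: "E \<subseteq> X \<times> Y" and r1: "\<And>r. r \<in> X \<Longrightarrow> \<exists>!c. (r, c) \<in> E"
    and c1: "\<And>c. c \<in> Y \<Longrightarrow> \<exists>!r. (r, c) \<in> E"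
    using E by (auto simp: matchings_def)
  have r2: "(r, c') \<in> E \<Longrightarrow> c' = c" for c' using r1[of r] sub rc by blast
  have c2: "(r', c) \<in> E \<Longrightarrow> r' = r" for r' using c1[of c] sub rc by blast
  show ?thesis unfolding matchings_def
  proof (intro CollectI conjI ballI)
    show "E - {(r, c)} \<subseteq> (X - {r}) \<times> (Y - {c})" using sub r2 c2 by blast
    show "\<exists>!c'. (r', c') \<in> E - {(r, c)}" if "r' \<in> X - {r}" for r' using r1[of r'] that by auto
    show "\<exists>!r'. (r', c') \<in> E - {(r, c)}" if "c' \<in> Y - {c}" for c' using c1[of c'] that by auto
  qed
qed

lemma matchings_insert:
  assumes E: "E \<in> matchings (X - {r}) (Y - {c})" and rc: "r \<in> X" "c \<in> Y"
  shows "insert (r, c) E \<in> matchings X Y"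
proof -
  have sub: "E \<subseteq> (X - {r}) \<times> (Y - {c})" and r1: "\<And>r'. r' \<in> X - {r} \<Longrightarrow> \<exists>!c. (r', c) \<in> E"
    and c1: "\<And>c'. c' \<in> Y - {c} \<Longrightarrow> \<exists>!r. (r, c') \<in> E"
    using E by (auto simp: matchings_def)
  show ?thesis unfolding matchings_def
  proof (intro CollectI conjI ballI)
    show "insert (r, c) E \<subseteq> X \<times> Y" using sub rc by blast
    show "\<exists>!c'. (r', c') \<in> insert (r, c) E" if "r' \<in> X" for r'
      using r1[of r'] that sub by (cases "r' = r") auto
    show "\<exists>!r'. (r', c') \<in> insert (r, c) E" if "c' \<in> Y" for c'
      using c1[of c'] that sub by (cases "c' = c") auto
  qed
qed

lemma matchings_notin: "E \<in> matchings (X - {r}) Y \<Longrightarrow> (r, c) \<notin> E"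
  unfolding matchings_def by blast

lemma bij_betw_matchings_insert:
  assumes "r \<in> X" "c \<in> Y"
  shows "bij_betw (insert (r, c)) (matchings (X - {r}) (Y - {c})) {E \<in> matchings X Y. (r, c) \<in> E}"
  by (rule bij_betw_byWitness[where f' = "\<lambda>E. E - {(r, c)}"])
     (auto simp: matchings_insert matchings_remove assms dest: matchings_notin)

text \<open>The rows of \<open>S\<close> go into \<open>B\<close> by \<open>h\<close>, the columns
  of \<open>S\<close> are reached from \<open>A\<close> by \<open>g\<close>, and \<open>k\<close>
  matches what remains of \<open>A\<close> and \<open>B\<close>; \<open>card S \<le> card A\<close>
  gives the room for this. The matching later supplies a monomial that lives outside the block
  \<open>S \<times> S\<close>.\<close>

lemma ex_matching_avoiding:
  assumes fin: "finite A" "finite B" "finite S" and disj: "A \<inter> S = {}" "B \<inter> S = {}"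
    and card: "card A = card B" "card S \<le> card A"
  obtains E where "E \<in> matchings (A \<union> S) (B \<union> S)" "E \<inter> S \<times> S = {}"
proof -
  obtain g where g: "inj_on g S" "g ` S \<subseteq> A"
    using card_le_inj[OF fin(3,1) card(2)] by blast
  obtain h where h: "inj_on h S" "h ` S \<subseteq> B"
    using card_le_inj[OF fin(3,2)] card by auto
  have "card (A - g ` S) = card (B - h ` S)"
    using card fin g h by (simp add: card_Diff_subset finite_subset card_image)
  then obtain k where k: "bij_betw k (A - g ` S) (B - h ` S)"
    using fin by (metis bij_betw_iff_card finite_Diff)
  define E where "E = (\<lambda>s. (s, h s)) ` S \<union> (\<lambda>s. (g s, s)) ` S \<union> (\<lambda>a. (a, k a)) ` (A - g ` S)"
  have kB: "k a \<in> B" "k a \<notin> h ` S" if "a \<in> A" "a \<notin> g ` S" for a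
    using bij_betwE[OF k] that by auto
  have kinj: "a = a'" if "k a = k a'" "a \<in> A" "a \<notin> g ` S" "a' \<in> A" "a' \<notin> g ` S" for a a'
    using k that unfolding bij_betw_def inj_on_def by auto
  have ksurj: "\<exists>a\<in>A - g ` S. b = k a" if "b \<in> B - h ` S" for b
    using k that unfolding bij_betw_def by blast
  have E: "(r, c) \<in> E \<longleftrightarrow> r \<in> S \<and> c = h r \<or> c \<in> S \<and> r = g c \<or> r \<in> A \<and> r \<notin> g ` S \<and> c = k r" for r c
    unfolding E_def by auto
  have gA: "g s \<in> A" "g s \<notin> S" "h s \<in> B" "h s \<notin> S" if "s \<in> S" for s
    using that g h disj by auto
  have "E \<in> matchings (A \<union> S) (B \<union> S)"
    unfolding matchings_def
  proof (intro CollectI conjI ballI)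
    show "E \<subseteq> (A \<union> S) \<times> (B \<union> S)" using g h kB unfolding E_def by auto
    fix r assume "r \<in> A \<union> S"
    then consider "r \<in> S" "r \<notin> A" | s where "s \<in> S" "r = g s" | "r \<in> A" "r \<notin> g ` S" "r \<notin> S"
      using disj by auto
    thus "\<exists>!c. (r, c) \<in> E"
    proof cases
      case 1
      hence "(r, c) \<in> E \<longleftrightarrow> c = h r" for c using gA unfolding E by auto
      thus ?thesis by simp
    next
      case 2
      hence "(r, c) \<in> E \<longleftrightarrow> c = s" for c using gA inj_onD[OF g(1)] unfolding E by auto
      thus ?thesis by simp
    next
      case 3
      hence "(r, c) \<in> E \<longleftrightarrow> c = k r" for c unfolding E by auto
      thus ?thesis by simp
    qed
  next
    fix c assume "c \<in> B \<union> S"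
    then consider "c \<in> S" "c \<notin> B" | s where "s \<in> S" "c = h s"
      | a where "a \<in> A" "a \<notin> g ` S" "c = k a" "c \<in> B" "c \<notin> S" "c \<notin> h ` S"
      using ksurj disj kB by blast
    thus "\<exists>!r. (r, c) \<in> E"
    proof cases
      case 1
      hence "(r, c) \<in> E \<longleftrightarrow> r = g c" for r using gA kB unfolding E by auto
      thus ?thesis by simp
    next
      case 2
      moreover have "k a \<noteq> h s" if "a \<in> A" "a \<notin> g ` S" for a using kB[OF that] 2 by blast
      ultimately have "(r, c) \<in> E \<longleftrightarrow> r = s" for r
        using gA inj_onD[OF h(1)] unfolding E by metis
      thus ?thesis by simp
    next
      case 3
      hence "(r, c) \<in> E \<longleftrightarrow> r = a" for r using kinj unfolding E by auto
      thus ?thesis by simp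
    qed
  qed
  moreover have "E \<inter> S \<times> S = {}"
    using g h disj unfolding E_def by auto
  ultimately show ?thesis using that by blast
qed

text \<open>\<open>f i\<close> is the coefficient function of a Laurent polynomial in the entries of a matrix with rows
  \<open>A \<union> S\<close> and columns \<open>B \<union> S\<close>. It multiplies an immanant-like polynomial of the matrix without row
  and column \<open>i\<close>, in which the monomial of the matching \<open>E\<close> has coefficient \<open>c i E\<close>.\<close>

definition syzygy ::
  "'b set \<Rightarrow> 'b set \<Rightarrow> 'b set \<Rightarrow> ('b \<Rightarrow> ('b \<times> 'b) set \<Rightarrow> 'a::field) \<Rightarrow>
   ('b \<Rightarrow> ('b \<times> 'b \<Rightarrow> int) \<Rightarrow> 'a) \<Rightarrow> bool" where
  "syzygy S A B c f \<longleftrightarrow>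
     (\<forall>m. (\<Sum>i\<in>S. \<Sum>E\<in>matchings (A \<union> S - {i}) (B \<union> S - {i}).
             c i E * f i (\<lambda>e. m e - of_bool (e \<in> E))) = 0)"

text \<open>Pairs, so that the cardinality is the total number of monomials of the tuple, those of
  different \<open>f i\<close> being counted separately.\<close>

definition support :: "'b set \<Rightarrow> ('b \<Rightarrow> 'm \<Rightarrow> 'a::zero) \<Rightarrow> ('b \<times> 'm) set" where
  "support S f = {(i, m). i \<in> S \<and> f i m \<noteq> 0}"

text \<open>Transposing the matrix turns columns into rows, so that the doubling argument has to be
  carried out for rows only.\<close>

lemma syzygy_swap:
  assumes "syzygy S A B c f"
  shows "syzygy S B A (\<lambda>i E. c i (prod.swap ` E)) (\<lambda>i m. f i (m \<circ> prod.swap))"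
  unfolding syzygy_def
proof (intro allI)
  fix m :: "'a \<times> 'a \<Rightarrow> int"
  have "(\<Sum>i\<in>S. \<Sum>E\<in>matchings (B \<union> S - {i}) (A \<union> S - {i}).
          c i (prod.swap ` E) * f i ((\<lambda>e. m e - of_bool (e \<in> E)) \<circ> prod.swap))
      = (\<Sum>i\<in>S. \<Sum>E\<in>matchings (A \<union> S - {i}) (B \<union> S - {i}).
          c i E * f i (\<lambda>e. (m \<circ> prod.swap) e - of_bool (e \<in> E)))"
  proof (rule sum.cong[OF refl])
    fix i
    have sw: "prod.swap e \<in> E \<longleftrightarrow> e \<in> prod.swap ` E" for e and E :: "('a \<times> 'a) set"
      by (metis imageE imageI swap_swap)
    show "(\<Sum>E\<in>matchings (B \<union> S - {i}) (A \<union> S - {i}).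
            c i (prod.swap ` E) * f i ((\<lambda>e. m e - of_bool (e \<in> E)) \<circ> prod.swap))
        = (\<Sum>E\<in>matchings (A \<union> S - {i}) (B \<union> S - {i}).
            c i E * f i (\<lambda>e. (m \<circ> prod.swap) e - of_bool (e \<in> E)))"
      by (subst sum.reindex_bij_betw[OF bij_betw_matchings_swap, symmetric])
         (simp add: o_def sw)
  qed
  thus "(\<Sum>i\<in>S. \<Sum>E\<in>matchings (B \<union> S - {i}) (A \<union> S - {i}).
          c i (prod.swap ` E) * f i ((\<lambda>e. m e - of_bool (e \<in> E)) \<circ> prod.swap)) = 0"
    using assms unfolding syzygy_def by simp
qed

text \<open>The condition \<open>face\<close> forbids trading the variable at \<open>(r, c1)\<close> for the one at \<open>(r, c0)\<close> in
  a monomial, so only matchings through \<open>(r, c0)\<close> contribute to the selected part of the relation.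
  It holds for initial forms with respect to gradings that favour \<open>(r, c0)\<close>.\<close>

lemma syzygy_face:
  assumes syz: "syzygy S A B c f" and fin: "finite A" "finite B" "finite S"
    and r: "r \<in> A" "r \<notin> S" and c: "c0 \<in> B" "c0 \<notin> S"
    and row: "\<And>m m'. (\<And>c'. m (r, c') = m' (r, c')) \<Longrightarrow> P m \<longleftrightarrow> P m'"
    and face: "\<And>i m m' c1. i \<in> S \<Longrightarrow> P m \<Longrightarrow> c1 \<noteq> c0 \<Longrightarrow>
      (\<And>c'. m' (r, c') = m (r, c') + of_bool (c' = c0) - of_bool (c' = c1)) \<Longrightarrow> f i m' = 0"
  shows "syzygy S (A - {r}) (B - {c0}) (\<lambda>i E. c i (insert (r, c0) E))
           (\<lambda>i m. if P m then f i m else 0)"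
  unfolding syzygy_def
proof (intro allI)
  fix m :: "'a \<times> 'a \<Rightarrow> int"
  let ?X = "\<lambda>i. A \<union> S - {i}" and ?Y = "\<lambda>i. B \<union> S - {i}"
  have sub: "A - {r} \<union> S - {i} = ?X i - {r}" "B - {c0} \<union> S - {i} = ?Y i - {c0}" for i
    using r c by auto
  show "(\<Sum>i\<in>S. \<Sum>E\<in>matchings (A - {r} \<union> S - {i}) (B - {c0} \<union> S - {i}).
     c i (insert (r, c0) E) *
     (if P (\<lambda>e. m e - of_bool (e \<in> E)) then f i (\<lambda>e. m e - of_bool (e \<in> E)) else 0)) = 0"
    (is "?L = 0")
  proof (cases "P m")
    \<comment> \<open>\<open>P\<close> sees only row \<open>r\<close>, which no matching of the
      smaller matrix touches, so all terms are switched off together.\<close>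
    case False
    have "\<not> P (\<lambda>e. m e - of_bool (e \<in> E))" if "E \<in> matchings (?X i - {r}) (?Y i - {c0})" for i E
      using False row[of m "\<lambda>e. m e - of_bool (e \<in> E)"] matchings_notin[OF that] by simp
    thus ?thesis by (simp add: sub)
  next
    case True
    \<comment> \<open>The smaller relation at \<open>m\<close> is the given one at \<open>m\<close>
      times the variable at \<open>(r, c0)\<close>: matchings through \<open>(r, c0)\<close> lose
      that edge, and the terms of all others vanish by \<open>face\<close>.\<close>
    let ?m = "\<lambda>e. m e + of_bool (e = (r, c0))"
    have "?L = (\<Sum>i\<in>S. \<Sum>E\<in>matchings (?X i) (?Y i). c i E * f i (\<lambda>e. ?m e - of_bool (e \<in> E)))"
    proof (rule sum.cong[OF refl])
      fix i assume i: "i \<in> S"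
      have mem: "r \<in> ?X i" "c0 \<in> ?Y i" using i r c by auto
      let ?g = "\<lambda>E. c i E * f i (\<lambda>e. ?m e - of_bool (e \<in> E))"
      have "(\<Sum>E\<in>matchings (A - {r} \<union> S - {i}) (B - {c0} \<union> S - {i}). c i (insert (r, c0) E) *
         (if P (\<lambda>e. m e - of_bool (e \<in> E)) then f i (\<lambda>e. m e - of_bool (e \<in> E)) else 0))
         = (\<Sum>E\<in>matchings (?X i - {r}) (?Y i - {c0}). ?g (insert (r, c0) E))"
        unfolding sub
      proof (rule sum.cong[OF refl])
        fix E assume E: "E \<in> matchings (?X i - {r}) (?Y i - {c0})"
        have "P (\<lambda>e. m e - of_bool (e \<in> E))"
          using True row[of m "\<lambda>e. m e - of_bool (e \<in> E)"] matchings_notin[OF E] by simp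
        moreover have "(\<lambda>e. ?m e - of_bool (e \<in> insert (r, c0) E)) = (\<lambda>e. m e - of_bool (e \<in> E))"
          using matchings_notin[OF E] by (intro ext) (auto simp: of_bool_def)
        ultimately show "c i (insert (r, c0) E) *
          (if P (\<lambda>e. m e - of_bool (e \<in> E)) then f i (\<lambda>e. m e - of_bool (e \<in> E)) else 0)
          = ?g (insert (r, c0) E)" by simp
      qed
      also have "\<dots> = (\<Sum>E\<in>{E \<in> matchings (?X i) (?Y i). (r, c0) \<in> E}. ?g E)"
        by (rule sum.reindex_bij_betw[OF bij_betw_matchings_insert[OF mem]])
      also have "\<dots> = (\<Sum>E\<in>matchings (?X i) (?Y i). ?g E)"
      proof (rule sum.mono_neutral_left)
        show "finite (matchings (?X i) (?Y i))" by (rule finite_matchings) (simp_all add: fin)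
        have "?g E = 0" if E: "E \<in> matchings (?X i) (?Y i)" "(r, c0) \<notin> E" for E
        proof -
          obtain c1 where c1: "(r, c1) \<in> E" "\<And>c'. (r, c') \<in> E \<Longrightarrow> c' = c1"
            using matchings_row[OF E(1) mem(1)] by metis
          have "c1 \<noteq> c0" using c1(1) E(2) by blast
          have "f i (\<lambda>e. ?m e - of_bool (e \<in> E)) = 0"
          proof (rule face[OF i True \<open>c1 \<noteq> c0\<close>])
            fix c'
            have "(r, c') \<in> E \<longleftrightarrow> c' = c1" using c1 by blast
            thus "?m (r, c') - of_bool ((r, c') \<in> E) = m (r, c') + of_bool (c' = c0) - of_bool (c' = c1)"
              by simp
          qed
          thus ?thesis by simp
        qed
        thus "\<forall>E\<in>matchings (?X i) (?Y i) - {E \<in> matchings (?X i) (?Y i). (r, c0) \<in> E}. ?g E = 0"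
          by blast
      qed blast
      finally show "(\<Sum>E\<in>matchings (A - {r} \<union> S - {i}) (B - {c0} \<union> S - {i}). c i (insert (r, c0) E) *
         (if P (\<lambda>e. m e - of_bool (e \<in> E)) then f i (\<lambda>e. m e - of_bool (e \<in> E)) else 0))
         = (\<Sum>E\<in>matchings (?X i) (?Y i). ?g E)" .
    qed
    also have "\<dots> = 0" using syz unfolding syzygy_def by simp
    finally show ?thesis .
  qed
qed

text \<open>Suppose all monomials agree outside \<open>S \<times> S\<close>. Take a term
  \<open>m0\<close> of \<open>f i0\<close> and a matching \<open>E0\<close> avoiding that block. Any
  matching contributing to the coefficient at \<open>m0\<close> times the monomial of
  \<open>E0\<close> must use the same edges outside the block, hence contains \<open>E0\<close>,
  hence equals it; one nonzero term is left with nothing to cancel it.\<close>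

lemma syzygy_varies_outside:
  assumes syz: "syzygy S A B c f" and fin: "finite A" "finite B" "finite S"
    and disj: "A \<inter> S = {}" "B \<inter> S = {}" and card: "card A = card B" "card S \<le> card A"
    and nz: "\<And>i E. i \<in> S \<Longrightarrow> E \<in> matchings (A \<union> S - {i}) (B \<union> S - {i}) \<Longrightarrow> c i E \<noteq> 0"
    and ne: "support S f \<noteq> {}"
  shows "\<exists>a b i j m m'. (i, m) \<in> support S f \<and> (j, m') \<in> support S f \<and>
    (a \<in> A \<or> b \<in> B) \<and> m (a, b) \<noteq> m' (a, b)"
proof (rule ccontr)
  assume varies: "\<not> ?thesis"
  have const: "m (a, b) = m' (a, b)"
    if "(i, m) \<in> support S f" "(j, m') \<in> support S f" "a \<in> A \<or> b \<in> B" for i j m m' a b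
  proof (rule ccontr)
    assume "m (a, b) \<noteq> m' (a, b)"
    with that have "(i, m) \<in> support S f \<and> (j, m') \<in> support S f \<and>
      (a \<in> A \<or> b \<in> B) \<and> m (a, b) \<noteq> m' (a, b)" by simp
    with varies show False by (elim notE) (intro exI)
  qed
  obtain i0 m0 where im0: "(i0, m0) \<in> support S f" using ne by auto
  hence i0: "i0 \<in> S" "f i0 m0 \<noteq> 0" by (auto simp: support_def)
  have "finite (S - {i0})" "A \<inter> (S - {i0}) = {}" "B \<inter> (S - {i0}) = {}" "card (S - {i0}) \<le> card A"
    using fin disj card(2) card_Diff1_le[of S i0] by auto
  from ex_matching_avoiding[OF fin(1,2) this(1-3) card(1) this(4)]
  obtain E0 where "E0 \<in> matchings (A \<union> (S - {i0})) (B \<union> (S - {i0}))"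
    "E0 \<inter> (S - {i0}) \<times> (S - {i0}) = {}" by blast
  moreover have un: "A \<union> (S - {i0}) = A \<union> S - {i0}" "B \<union> (S - {i0}) = B \<union> S - {i0}"
    using i0 disj by auto
  ultimately have E0: "E0 \<in> matchings (A \<union> S - {i0}) (B \<union> S - {i0})"
    "E0 \<inter> (S - {i0}) \<times> (S - {i0}) = {}" by simp_all
  hence E0_out: "a \<in> A \<or> b \<in> B" if "(a, b) \<in> E0" for a b
    using subsetD[OF matchings_subset[OF E0(1)] that] E0(2) that by auto
  let ?m = "\<lambda>e. m0 e + of_bool (e \<in> E0)"
  have uniq: "f i (\<lambda>e. ?m e - of_bool (e \<in> E)) = 0"
    if i: "i \<in> S" and E: "E \<in> matchings (A \<union> S - {i}) (B \<union> S - {i})"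
      and neq: "i \<noteq> i0 \<or> E \<noteq> E0" for i E
  proof (rule ccontr)
    assume f: "f i (\<lambda>e. ?m e - of_bool (e \<in> E)) \<noteq> 0"
    have "(i, \<lambda>e. ?m e - of_bool (e \<in> E)) \<in> support S f" using i f by (simp add: support_def)
    note out = const[OF im0 this]
    have "E0 \<subseteq> E"
    proof (rule subrelI)
      fix a b assume ab: "(a, b) \<in> E0"
      have "m0 (a, b) = m0 (a, b) + of_bool ((a, b) \<in> E0) - of_bool ((a, b) \<in> E)"
        by (rule out[OF E0_out[OF ab]])
      thus "(a, b) \<in> E" using ab by (cases "(a, b) \<in> E") simp_all
    qed
    moreover have "card E = card E0"
      using matchings_card[OF E] matchings_card[OF E0(1)] i i0 fin by simp
    moreover have "finite E"
      using matchings_subset[OF E] fin by (meson finite_Diff finite_SigmaI finite_UnI finite_subset)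
    ultimately have "E = E0" by (metis card_subset_eq)
    \<comment> \<open>A matching determines its set of rows, and the row of \<open>S\<close> missing
      from it is the index.\<close>
    moreover have "A \<union> S - {i} = A \<union> S - {i0}"
      using matchings_fst[OF E] matchings_fst[OF E0(1)] \<open>E = E0\<close> by simp
    hence "i = i0" using i i0(1) by (metis Diff_iff UnI2 singletonD singletonI)
    ultimately show False using neq by simp
  qed
  have "0 = (\<Sum>i\<in>S. \<Sum>E\<in>matchings (A \<union> S - {i}) (B \<union> S - {i}).
          c i E * f i (\<lambda>e. ?m e - of_bool (e \<in> E)))"
    using syz unfolding syzygy_def by simp
  also have "\<dots> = (\<Sum>E\<in>matchings (A \<union> S - {i0}) (B \<union> S - {i0}).
          c i0 E * f i0 (\<lambda>e. ?m e - of_bool (e \<in> E)))"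
  proof -
    have "(\<Sum>E\<in>matchings (A \<union> S - {i}) (B \<union> S - {i}). c i E * f i (\<lambda>e. ?m e - of_bool (e \<in> E))) = 0"
      if "i \<in> S - {i0}" for i
      using uniq[of i] that by (intro sum.neutral) simp
    thus ?thesis by (simp add: sum.remove[OF fin(3) i0(1)])
  qed
  also have "\<dots> = c i0 E0 * f i0 (\<lambda>e. ?m e - of_bool (e \<in> E0))"
  proof -
    have "finite (matchings (A \<union> S - {i0}) (B \<union> S - {i0}))" using fin by (intro finite_matchings) auto
    moreover have "c i0 E * f i0 (\<lambda>e. ?m e - of_bool (e \<in> E)) = 0"
      if "E \<in> matchings (A \<union> S - {i0}) (B \<union> S - {i0}) - {E0}" for E
      using uniq[OF i0(1), of E] that by simp
    hence "(\<Sum>E\<in>matchings (A \<union> S - {i0}) (B \<union> S - {i0}) - {E0}.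
        c i0 E * f i0 (\<lambda>e. ?m e - of_bool (e \<in> E))) = 0" by (intro sum.neutral) blast
    ultimately show ?thesis by (simp add: sum.remove[OF _ E0(1)])
  qed
  also have "\<dots> \<noteq> 0" using nz[OF i0(1) E0(1)] i0 by simp
  finally show False by simp
qed

section \<open>Exponential lower bound on the support of a relation\<close>

lemma card_two_parts:
  assumes "finite F" "G \<subseteq> F" "H \<subseteq> F" "G \<inter> H = {}" "N \<le> card G" "N \<le> card H"
  shows "2 * N \<le> card F"
proof -
  have "card G + card H = card (G \<union> H)"
    using assms by (simp add: card_Un_disjoint finite_subset)
  also have "\<dots> \<le> card F" using assms by (intro card_mono) auto
  finally show ?thesis using assms by simp
qed

text \<open>Two faces of the support, cut out by mutually exclusive conditions on row
  \<open>r\<close>, are again relations, each with one row of \<open>A\<close> and one column of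
  \<open>B\<close> less. The bound \<open>N\<close> for those enters as the assumption
  \<open>IH\<close>, so that the lemma can serve columns too, after transposition.\<close>

lemma syzygy_row_doubling:
  fixes f :: "'b \<Rightarrow> ('b \<times> 'b \<Rightarrow> int) \<Rightarrow> 'a::field"
  assumes syz: "syzygy S A B c f" and fin: "finite A" "finite B" "finite S"
    and disj: "A \<inter> S = {}" "B \<inter> S = {}" and card: "card A = card B" "2 \<le> card A"
    and nz: "\<And>i E. i \<in> S \<Longrightarrow> E \<in> matchings (A \<union> S - {i}) (B \<union> S - {i}) \<Longrightarrow> c i E \<noteq> 0"
    and finF: "finite (support S f)"
    and r: "r \<in> A" and vary: "(i, m) \<in> support S f" "(j, m') \<in> support S f" "m (r, b) \<noteq> m' (r, b)"
    and IH: "\<And>A' B' c' (f' :: 'b \<Rightarrow> ('b \<times> 'b \<Rightarrow> int) \<Rightarrow> 'a). syzygy S A' B' c' f' \<Longrightarrow> finite A' \<Longrightarrow> finite B' \<Longrightarrow> A' \<inter> S = {} \<Longrightarrow>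
      B' \<inter> S = {} \<Longrightarrow> card A' = card B' \<Longrightarrow> card A' = card A - 1 \<Longrightarrow>
      (\<And>i E. i \<in> S \<Longrightarrow> E \<in> matchings (A' \<union> S - {i}) (B' \<union> S - {i}) \<Longrightarrow> c' i E \<noteq> 0) \<Longrightarrow>
      finite (support S f') \<Longrightarrow> support S f' \<noteq> {} \<Longrightarrow> N \<le> card (support S f')"
  shows "2 * N \<le> card (support S f)"
proof -
  \<comment> \<open>One face: restrict to \<open>P\<close>, shrink the matrix by
    \<open>syzygy_face\<close>, apply \<open>IH\<close>.\<close>
  have part: "N \<le> card {(i, m) \<in> support S f. P m}"
    if c0: "c0 \<in> B" and row: "\<And>m m'. (\<And>c'. m (r, c') = m' (r, c')) \<Longrightarrow> P m \<longleftrightarrow> P m'"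
    and face: "\<And>i m m' c1. i \<in> S \<Longrightarrow> P m \<Longrightarrow> c1 \<noteq> c0 \<Longrightarrow>
      (\<And>c'. m' (r, c') = m (r, c') + of_bool (c' = c0) - of_bool (c' = c1)) \<Longrightarrow> f i m' = 0"
    and ne: "(i, m) \<in> support S f" "P m" for c0 P i m
  proof -
    let ?f = "\<lambda>i m. if P m then f i m else 0"
    have supp: "support S ?f = {(i, m) \<in> support S f. P m}" by (auto simp: support_def)
    have rS: "r \<notin> S" "c0 \<notin> S" using disj r c0 by auto
    have "syzygy S (A - {r}) (B - {c0}) (\<lambda>i E. c i (insert (r, c0) E)) ?f"
      by (rule syzygy_face[OF syz fin r rS(1) c0 rS(2)]) (fact row, fact face)
    hence "N \<le> card (support S ?f)"
    proof (rule IH)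
      show "card (A - {r}) = card (B - {c0})" "card (A - {r}) = card A - 1"
        using card r c0 by simp_all
      fix i E assume i: "i \<in> S" and E: "E \<in> matchings (A - {r} \<union> S - {i}) (B - {c0} \<union> S - {i})"
      have "A - {r} \<union> S - {i} = A \<union> S - {i} - {r}" "B - {c0} \<union> S - {i} = B \<union> S - {i} - {c0}"
        using rS by auto
      thus "c i (insert (r, c0) E) \<noteq> 0"
        using E i r c0 rS by (intro nz matchings_insert) auto
    next
      show "finite (support S ?f)" unfolding supp by (rule finite_subset[OF _ finF]) auto
      show "support S ?f \<noteq> {}" unfolding supp using ne by auto
    qed (use fin disj in auto)
    thus ?thesis unfolding supp .
  qed
  let ?F = "support S f"
  define V where "V e = (\<lambda>(i, m). m e) ` ?F" for e
  have finV: "finite (V e)" for e unfolding V_def using finF by simp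
  have inV: "m e \<in> V e" if "(i, m) \<in> ?F" for i m e
    using imageI[OF that, of "\<lambda>(i, m). m e"] unfolding V_def by simp
  have f0: "f i m = 0" if "i \<in> S" "m e \<notin> V e" for i m e
    using that inV unfolding support_def by blast
  have "1 < card B" using card by simp
  then obtain c0 c1 where c01: "c0 \<in> B" "c1 \<in> B" "c0 \<noteq> c1"
    using card_le_Suc0_iff_eq[OF fin(2)] by fastforce
  show ?thesis
  proof (cases "\<exists>v. V (r, c0) = {v}")
    \<comment> \<open>The exponent at \<open>(r, c0)\<close> is constant, so raising it leaves the
      support, and any further condition on row \<open>r\<close> still gives a face for
      \<open>c0\<close>. The two values at \<open>(r, b)\<close> separate two such faces.\<close>
    case True
    then obtain v where v: "V (r, c0) = {v}" by blast
    have im: "m (r, c0) = v" "m' (r, c0) = v" using inV[OF vary(1)] inV[OF vary(2)] v by auto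
    have split: "N \<le> card {(i, x) \<in> ?F. x (r, c0) = v \<and> x (r, b) = n (r, b)}"
      if "(h, n) \<in> ?F" "n (r, c0) = v" for h n
    proof (rule part[OF c01(1), of "\<lambda>x. x (r, c0) = v \<and> x (r, b) = n (r, b)" h n])
      fix i m m' c1 assume a: "i \<in> S" "m (r, c0) = v \<and> m (r, b) = n (r, b)" "c1 \<noteq> c0"
        "\<And>c'. m' (r, c') = m (r, c') + of_bool (c' = c0) - of_bool (c' = c1)"
      have "m' (r, c0) = v + 1" using a by simp
      thus "f i m' = 0" using f0[OF a(1), of m' "(r, c0)"] v by simp
    qed (use that in simp_all)
    show ?thesis
    proof (rule card_two_parts[OF finF _ _ _ split[OF vary(1) im(1)] split[OF vary(2) im(2)]])
      show "{(i, x) \<in> ?F. x (r, c0) = v \<and> x (r, b) = m (r, b)} \<inter>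
        {(i, x) \<in> ?F. x (r, c0) = v \<and> x (r, b) = m' (r, b)} = {}"
        using vary(3) by fastforce
    qed blast+
  next
    \<comment> \<open>The exponent at \<open>(r, c0)\<close> varies. Its maximum \<open>d\<close>
      gives a face for \<open>c0\<close>. Its minimum \<open>l\<close>, refined by the largest
      exponent \<open>w\<close> at \<open>(r, c1)\<close>, gives one for \<open>c1\<close>: a trade
      either lowers \<open>(r, c0)\<close> below \<open>l\<close> or raises \<open>(r, c1)\<close>
      above \<open>w\<close>.\<close>
    case False
    have Vne: "V (r, c0) \<noteq> {}" using inV[OF vary(1)] by blast
    define d where "d = Max (V (r, c0))"
    define l where "l = Min (V (r, c0))"
    have d: "d \<in> V (r, c0)" and l: "l \<in> V (r, c0)" unfolding d_def l_def using finV Vne by auto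
    have max: "x \<le> d" "l \<le> x" if "x \<in> V (r, c0)" for x
      unfolding d_def l_def using finV that by auto
    have "l \<noteq> d" using max False Vne by (metis antisym d singletonI subsetI subset_singletonD)
    obtain i1 m1 where m1: "(i1, m1) \<in> ?F" "m1 (r, c0) = d" using d unfolding V_def by auto
    define W where "W = (\<lambda>(i, m). m (r, c1)) ` {(i, m) \<in> ?F. m (r, c0) = l}"
    have finW: "finite W" unfolding W_def by (intro finite_imageI finite_subset[OF _ finF]) auto
    have Wne: "W \<noteq> {}" using l unfolding W_def V_def by auto
    define w where "w = Max W"
    have "w \<in> W" unfolding w_def using finW Wne by auto
    then obtain i2 m2 where m2: "(i2, m2) \<in> ?F" "m2 (r, c0) = l" "m2 (r, c1) = w"
      unfolding W_def by auto
    have wmax: "m (r, c1) \<le> w" if "i \<in> S" "f i m \<noteq> 0" "m (r, c0) = l" for i m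
    proof -
      have "m (r, c1) \<in> W" using that unfolding W_def support_def by force
      thus ?thesis unfolding w_def using finW by simp
    qed
    show ?thesis
    proof (rule card_two_parts[OF finF])
      show "N \<le> card {(i, x) \<in> ?F. x (r, c0) = d}"
      proof (rule part[OF c01(1), of "\<lambda>x. x (r, c0) = d" i1 m1])
        fix i m m' c1 assume a: "i \<in> S" "m (r, c0) = d" "c1 \<noteq> c0"
          "\<And>c'. m' (r, c') = m (r, c') + of_bool (c' = c0) - of_bool (c' = c1)"
        have "m' (r, c0) = d + 1" using a by simp
        thus "f i m' = 0" using f0[OF a(1), of m' "(r, c0)"] max(1)[of "d + 1"] by auto
      qed (simp_all add: m1)
      show "N \<le> card {(i, x) \<in> ?F. x (r, c0) = l \<and> x (r, c1) = w}"
      proof (rule part[OF c01(2), of "\<lambda>x. x (r, c0) = l \<and> x (r, c1) = w" i2 m2])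
        fix i m m' c2 assume a: "i \<in> S" "m (r, c0) = l \<and> m (r, c1) = w" "c2 \<noteq> c1"
          "\<And>c'. m' (r, c') = m (r, c') + of_bool (c' = c1) - of_bool (c' = c2)"
        show "f i m' = 0"
        proof (cases "c2 = c0")
          case True
          hence "m' (r, c0) = l - 1" using a c01 by simp
          thus ?thesis using f0[OF a(1), of m' "(r, c0)"] max(2)[of "l - 1"] by auto
        next
          case False
          hence "m' (r, c0) = l" "m' (r, c1) = w + 1" using a c01 by auto
          thus ?thesis using wmax[OF a(1), of m'] by auto
        qed
      qed (simp_all add: m2)
    qed (use \<open>l \<noteq> d\<close> in auto)
  qed
qed

text \<open>Induction on the surplus \<open>q\<close> of \<open>card A\<close> over
  \<open>card S\<close>: some row or column outside the block varies, and splitting there doubles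
  the bound while \<open>A\<close> and \<open>B\<close> lose one element each. The surplus maintains
  \<open>card S \<le> card A\<close>, which \<open>syzygy_varies_outside\<close> needs for its
  matching.\<close>

lemma card_support_syzygy:
  fixes f :: "'b \<Rightarrow> ('b \<times> 'b \<Rightarrow> int) \<Rightarrow> 'a::field"
  assumes "syzygy S A B c f" "finite A" "finite B" "finite S"
    "A \<inter> S = {}" "B \<inter> S = {}" "card A = card B" "card A = card S + q"
    "\<And>i E. i \<in> S \<Longrightarrow> E \<in> matchings (A \<union> S - {i}) (B \<union> S - {i}) \<Longrightarrow> c i E \<noteq> 0"
    "finite (support S f)" "support S f \<noteq> {}"
  shows "2 ^ q \<le> card (support S f)"
  using assms
proof (induction q arbitrary: A B c f)
  case 0
  thus ?case by (simp add: Suc_le_eq card_gt_0_iff)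
next
  case (Suc q)
  note syz = Suc.prems(1) and fin = Suc.prems(2-4) and disj = Suc.prems(5,6)
    and card = Suc.prems(7,8) and nz = Suc.prems(9) and F = Suc.prems(10,11)
  \<comment> \<open>A nonzero relation has an index, so \<open>card A = card S + Suc q\<close> is at
    least 2, which leaves two columns of \<open>B\<close> for the splitting.\<close>
  have "S \<noteq> {}" using F by (auto simp: support_def)
  hence "0 < card S" using fin by (simp add: card_gt_0_iff)
  hence card2: "2 \<le> card A" using card by simp
  have IH: "2 ^ q \<le> card (support S f')"
    if "syzygy S A' B' c' f'" "finite A'" "finite B'" "A' \<inter> S = {}"
      "B' \<inter> S = {}" "card A' = card B'" "card A' = card A - 1"
      "\<And>i E. i \<in> S \<Longrightarrow> E \<in> matchings (A' \<union> S - {i}) (B' \<union> S - {i}) \<Longrightarrow> c' i E \<noteq> 0"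
      "finite (support S f')" "support S f' \<noteq> {}" for A' B' c' and f' :: "'b \<Rightarrow> ('b \<times> 'b \<Rightarrow> int) \<Rightarrow> 'a"
    by (rule Suc.IH[OF that(1-3) fin(3) that(4-6)]) (use that card in auto)
  have "card S \<le> card A" using card by simp
  from syzygy_varies_outside[OF syz fin disj card(1) this nz F(2)]
  obtain a b i j m m' where v: "(i, m) \<in> support S f" "(j, m') \<in> support S f"
    "a \<in> A \<or> b \<in> B" "m (a, b) \<noteq> m' (a, b)" by blast
  show ?case
  proof (cases "a \<in> A")
    case True
    have "2 * 2 ^ q \<le> card (support S f)"
      by (rule syzygy_row_doubling[OF syz fin disj card(1) card2 nz F(1) True v(1,2,4)])
         (assumption | rule IH)+
    thus ?thesis by simp
  next
    \<comment> \<open>The variation lies in a column of \<open>B\<close>; transposition makes it a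
      row and maps the support bijectively.\<close>
    case False
    let ?f = "\<lambda>i m. f i (m \<circ> prod.swap)"
    have "bij_betw (\<lambda>(i, m). (i, m \<circ> prod.swap)) (support S ?f) (support S f)"
      by (rule bij_betw_byWitness[where f' = "\<lambda>(i, m). (i, m \<circ> prod.swap)"])
         (auto simp: support_def o_def)
    note bij = bij_betw_same_card[OF this] bij_betw_finite[OF this]
    have "2 * 2 ^ q \<le> card (support S ?f)"
    proof (rule syzygy_row_doubling[OF syzygy_swap[OF syz] fin(2,1,3) disj(2,1) card(1)[symmetric]])
      show "(i, m \<circ> prod.swap) \<in> support S ?f" "(j, m' \<circ> prod.swap) \<in> support S ?f"
        using v by (auto simp: support_def o_def)
      show "(m \<circ> prod.swap) (b, a) \<noteq> (m' \<circ> prod.swap) (b, a)" using v by simp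
      show "b \<in> B" using v False by simp
      show "2 \<le> card B" using card card2 by simp
      show "finite (support S ?f)" using F bij by simp
      show "c i (prod.swap ` E) \<noteq> 0" if "i \<in> S" "E \<in> matchings (B \<union> S - {i}) (A \<union> S - {i})" for i E
        using nz that matchings_swap by blast
    qed (rule IH, (assumption | simp add: card)+)
    thus ?thesis using bij by simp
  qed
qed

section \<open>Derivations and sparsity\<close>

text \<open>The formal derivative by coefficients: that of \<open>m\<close> comes from the single
  monomial \<open>m\<close> times \<open>v\<close>. The support stays finite because this shift is
  injective.\<close>

lift_definition pderivative :: "'v \<Rightarrow> ('v, 'a::comm_semiring_1) mpoly \<Rightarrow> ('v, 'a) mpoly" is
  "\<lambda>v p m. of_nat (Suc (Poly_Mapping.lookup m v)) * p (m + Poly_Mapping.single v 1)"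
proof -
  fix v :: 'v and p :: "'v monomial \<Rightarrow> 'a"
  assume "finite {m. p m \<noteq> 0}"
  hence "finite ((\<lambda>m. m + Poly_Mapping.single v 1) -` {m. p m \<noteq> 0})"
    by (rule finite_vimageI) (simp add: inj_on_def)
  thus "finite {m. of_nat (Suc (Poly_Mapping.lookup m v)) * p (m + Poly_Mapping.single v 1) \<noteq> 0}"
    by (rule finite_subset[rotated]) auto
qed

lemma pderivative_0 [simp]: "pderivative v 0 = 0"
  by transfer simp

lemma pderivative_add: "pderivative v (p + q) = pderivative v p + pderivative v q"
  by transfer (simp add: algebra_simps)

lemma pderivative_sum: "pderivative v (\<Sum>i\<in>I. p i) = (\<Sum>i\<in>I. pderivative v (p i))"
  by (induction I rule: infinite_finite_induct) (simp_all add: pderivative_add)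

lemma minus_single_unique:
  assumes "Poly_Mapping.lookup m v \<noteq> 0"
  shows "m' + Poly_Mapping.single v 1 = m \<longleftrightarrow> m' = m - Poly_Mapping.single v (1::nat)"
proof
  assume m': "m' = m - Poly_Mapping.single v 1"
  show "m' + Poly_Mapping.single v 1 = m"
    unfolding m' using assms
    by (intro poly_mapping_eqI) (auto simp: lookup_add lookup_minus lookup_single when_def)
qed auto

lemma pderivative_single:
  "pderivative v (Poly_Mapping.single m a) =
     Poly_Mapping.single (m - Poly_Mapping.single v 1) (of_nat (Poly_Mapping.lookup m v) * a)"
proof (rule poly_mapping_eqI)
  fix m'
  show "Poly_Mapping.lookup (pderivative v (Poly_Mapping.single m a)) m' = Poly_Mapping.lookup
     (Poly_Mapping.single (m - Poly_Mapping.single v 1) (of_nat (Poly_Mapping.lookup m v) * a)) m'"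
  proof (cases "Poly_Mapping.lookup m v = 0")
    case True
    have "m \<noteq> m' + Poly_Mapping.single v 1" using True by (auto simp: lookup_add)
    thus ?thesis using True by (simp add: pderivative.rep_eq lookup_single)
  next
    case False
    have "m = m' + Poly_Mapping.single v 1 \<longleftrightarrow> m - Poly_Mapping.single v 1 = m'"
      using minus_single_unique[OF False, of m'] by metis
    moreover have "of_nat (Suc (Poly_Mapping.lookup (m - Poly_Mapping.single v 1) v)) =
        (of_nat (Poly_Mapping.lookup m v) :: 'b)"
      using False by (simp add: lookup_minus del: of_nat_Suc)
    ultimately show ?thesis
      by (auto simp: pderivative.rep_eq lookup_single when_def simp del: of_nat_Suc)
  qed
qed

lemma poly_mapping_add_induct [case_names single add]:
  assumes "\<And>m a. P (Poly_Mapping.single m a)" "\<And>p q. P p \<Longrightarrow> P q \<Longrightarrow> P (p + q)"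
  shows "P (p :: 'm \<Rightarrow>\<^sub>0 'a::comm_monoid_add)"
proof (induction p rule: update_induct)
  case const
  show ?case using assms(1)[of undefined 0] by simp
next
  case (update p m a)
  have "Poly_Mapping.update m a p = p + Poly_Mapping.single m a"
    using update(1) by (intro poly_mapping_eqI)
      (auto simp: lookup_update lookup_add lookup_single when_def in_keys_iff)
  thus ?case using assms update by simp
qed

lemma pderivative_mult:
  "pderivative v (p * q) = p * pderivative v q + q * pderivative v p"
proof (induction p rule: poly_mapping_add_induct)
  case (single m a)
  show ?case
  proof (induction q rule: poly_mapping_add_induct)
    case (single n b)
    \<comment> \<open>Subtraction of exponents is truncated. Where \<open>v\<close> is missing from
      \<open>m\<close> the two exponent vectors may differ, but then both coefficients are
      0.\<close>
    have m: "Poly_Mapping.single (m + n - Poly_Mapping.single v 1) (of_nat (Poly_Mapping.lookup m v) * a * b)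
      = Poly_Mapping.single (n + (m - Poly_Mapping.single v 1)) (of_nat (Poly_Mapping.lookup m v) * a * b)"
      for m n :: "'a monomial" and a b :: 'b
    proof (cases "Poly_Mapping.lookup m v = 0")
      case False
      hence "m + n - Poly_Mapping.single v 1 = n + (m - Poly_Mapping.single v 1)"
        by (intro poly_mapping_eqI) (auto simp: lookup_add lookup_minus lookup_single when_def)
      thus ?thesis by simp
    qed simp
    show ?case
      using m[of m n a b] m[of n m b a]
      by (simp add: mult_single pderivative_single lookup_add algebra_simps single_add)
  qed (simp add: pderivative_add algebra_simps)
qed (simp add: pderivative_add algebra_simps)

lemma keys_pderivative: "(\<lambda>m. m + Poly_Mapping.single v 1) ` Poly_Mapping.keys (pderivative v p) \<subseteq> Poly_Mapping.keys p"
  by (auto simp: in_keys_iff pderivative.rep_eq)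

lemma pderivative_eq_0: "v \<notin> vars p \<Longrightarrow> pderivative v p = 0"
proof (rule poly_mapping_eqI)
  fix m assume "v \<notin> vars p"
  hence "m + Poly_Mapping.single v 1 \<notin> Poly_Mapping.keys p"
    unfolding vars_def by (auto simp: lookup_add in_keys_iff[of v] simp del: lookup_not_eq_zero_eq_in_keys)
  thus "Poly_Mapping.lookup (pderivative v p) m = Poly_Mapping.lookup 0 m"
    by (simp add: pderivative.rep_eq in_keys_iff)
qed

section \<open>Numbers of monomials in sums, products and derivatives\<close>

definition sparsity :: "('m \<Rightarrow>\<^sub>0 'a::zero) \<Rightarrow> nat" where
  "sparsity p = card (Poly_Mapping.keys p)"

lemma sparsity_0 [simp]: "sparsity 0 = 0"
  by (simp add: sparsity_def)

lemma sparsity_single: "sparsity (Poly_Mapping.single m a) \<le> 1"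
  by (simp add: sparsity_def)

lemma sparsity_1 [simp]: "sparsity (1 :: 'm::zero \<Rightarrow>\<^sub>0 'a::zero_neq_one) = 1"
  by (simp add: sparsity_def)

lemma sparsity_pderivative: "sparsity (pderivative v p) \<le> sparsity p"
  unfolding sparsity_def
  by (rule card_inj_on_le[OF _ keys_pderivative]) (auto simp: inj_on_def)

lemma sparsity_add: "sparsity (p + q) \<le> sparsity p + sparsity q"
  unfolding sparsity_def
  by (rule order_trans[OF card_mono[OF _ keys_add] card_Un_le]) auto

lemma sparsity_uminus [simp]: "sparsity (- p :: 'm \<Rightarrow>\<^sub>0 'a::ab_group_add) = sparsity p"
  by (simp add: sparsity_def Poly_Mapping.keys.rep_eq)

lemma sparsity_mult:
  "sparsity (p * q :: 'm::monoid_add \<Rightarrow>\<^sub>0 'a::semiring_0) \<le> sparsity p * sparsity q"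
proof -
  have "sparsity (p * q) \<le> card ((\<lambda>(a, b). a + b) ` (Poly_Mapping.keys p \<times> Poly_Mapping.keys q))"
    unfolding sparsity_def by (rule card_mono) (use keys_mult[of p q] in auto)
  also have "\<dots> \<le> card (Poly_Mapping.keys p \<times> Poly_Mapping.keys q)" by (rule card_image_le) auto
  finally show ?thesis by (simp add: sparsity_def card_cartesian_product)
qed

lemma sparsity_sum: "sparsity (\<Sum>i\<in>I. p i) \<le> (\<Sum>i\<in>I. sparsity (p i))"
proof (induction I rule: infinite_finite_induct)
  case (insert i I)
  thus ?case using sparsity_add[of "p i" "sum p I"] by simp
qed simp_all

lemma sparsity_sum_list: "sparsity (sum_list ps) \<le> sum_list (map sparsity ps)"
proof (induction ps)
  case (Cons p ps)
  thus ?case using sparsity_add[of p "sum_list ps"] by simp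
qed simp

lemma sparsity_prod:
  "sparsity (\<Prod>i\<in>I. p i :: 'm::comm_monoid_add \<Rightarrow>\<^sub>0 'a::comm_semiring_1) \<le> (\<Prod>i\<in>I. sparsity (p i))"
proof (induction I rule: infinite_finite_induct)
  case (insert i I)
  have "sparsity (p i * prod p I) \<le> sparsity (p i) * (\<Prod>i\<in>I. sparsity (p i))"
    by (rule order_trans[OF sparsity_mult mult_le_mono2[OF insert.IH]])
  thus ?case using insert by simp
qed simp_all

lemma sparsity_of_nat_mult:
  "sparsity (of_nat n * p :: 'm::monoid_add \<Rightarrow>\<^sub>0 'a::semiring_1) \<le> sparsity p"
proof -
  have "sparsity (of_nat n * p) \<le> sparsity (Poly_Mapping.single 0 (of_nat n) :: 'm \<Rightarrow>\<^sub>0 'a) * sparsity p"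
    using sparsity_mult[of "Poly_Mapping.single 0 (of_nat n)" p] by simp
  also have "\<dots> \<le> 1 * sparsity p" by (intro mult_le_mono1 sparsity_single)
  finally show ?thesis by simp
qed

lemma sparsity_prod_le_power:
  fixes p :: "'i \<Rightarrow> 'm::comm_monoid_add \<Rightarrow>\<^sub>0 'a::comm_semiring_1"
  assumes "\<And>i. i \<in> I \<Longrightarrow> sparsity (p i) \<le> s"
  shows "sparsity (\<Prod>i\<in>I. p i) \<le> s ^ card I"
proof -
  have "(\<Prod>i\<in>I. sparsity (p i)) \<le> (\<Prod>i\<in>I. s)" using assms by (intro prod_mono) auto
  thus ?thesis using sparsity_prod[of p I] by simp
qed

section \<open>Leibniz rule for products of powers\<close>

lemma derivation_1:
  fixes D :: "'r::comm_ring_1 \<Rightarrow> 'r"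
  assumes "\<And>p q. D (p * q) = p * D q + q * D p"
  shows "D 1 = 0"
  using assms[of 1 1] by simp

lemma derivation_power:
  fixes D :: "'r::comm_ring_1 \<Rightarrow> 'r"
  assumes D: "\<And>p q. D (p * q) = p * D q + q * D p"
  shows "D (p ^ Suc e) = of_nat (Suc e) * p ^ e * D p"
proof (induction e)
  case (Suc e)
  have "D (p ^ Suc (Suc e)) = p * D (p ^ Suc e) + p ^ Suc e * D p" using D[of p "p ^ Suc e"] by simp
  thus ?case unfolding Suc.IH by (simp add: algebra_simps)
qed simp

lemma derivation_prod:
  fixes D :: "'r::comm_ring_1 \<Rightarrow> 'r"
  assumes D: "\<And>p q. D (p * q) = p * D q + q * D p" and fin: "finite L"
  shows "D (\<Prod>l\<in>L. g l) = (\<Sum>l\<in>L. D (g l) * (\<Prod>l'\<in>L - {l}. g l'))"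
  using fin
proof induction
  case empty
  thus ?case by (simp add: derivation_1[OF D])
next
  case (insert x L)
  have "(\<Sum>l\<in>L. D (g l) * (\<Prod>l'\<in>insert x L - {l}. g l')) = g x * (\<Sum>l\<in>L. D (g l) * (\<Prod>l'\<in>L - {l}. g l'))"
    unfolding sum_distrib_left
  proof (rule sum.cong[OF refl])
    fix l assume "l \<in> L"
    hence "insert x L - {l} = insert x (L - {l})" using insert by auto
    thus "D (g l) * (\<Prod>l'\<in>insert x L - {l}. g l') = g x * (D (g l) * (\<Prod>l'\<in>L - {l}. g l'))"
      using insert by (simp add: algebra_simps)
  qed
  moreover have "insert x L - {x} = L" using insert by auto
  ultimately show ?case using insert by (simp add: D algebra_simps)
qed

text \<open>All derivations vanishing on the factors outside \<open>R\<close> have the same cofactor on the left.\<close>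

lemma derivation_prod_powers:
  fixes D :: "'r::comm_ring_1 \<Rightarrow> 'r"
  assumes D: "\<And>p q. D (p * q) = p * D q + q * D p" and fin: "finite L" and R: "R \<subseteq> L"
    and e: "\<And>l. l \<in> R \<Longrightarrow> 1 \<le> e l" and D0: "\<And>l. l \<in> L - R \<Longrightarrow> D (g l) = 0"
  shows "D (\<Prod>l\<in>L. g l ^ e l) = (\<Prod>l\<in>L. g l ^ (if l \<in> R then e l - 1 else e l)) *
    (\<Sum>l\<in>R. of_nat (e l) * (D (g l) * (\<Prod>l'\<in>R - {l}. g l')))"
proof -
  have finR: "finite R" using fin R finite_subset by blast
  \<comment> \<open>For \<open>e l = 0\<close> the truncated exponent \<open>e l - 1\<close> does no
    harm: \<open>D 1 = 0\<close>, and the factor \<open>of_nat (e l)\<close> vanishes.\<close>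
  have power: "D (g l ^ e l) = of_nat (e l) * g l ^ (e l - 1) * D (g l)" for l
    using derivation_power[OF D, of "g l" "e l - 1"] by (cases "e l") (auto simp: derivation_1[OF D])
  have 1: "D (\<Prod>l\<in>L. g l ^ e l) = (\<Sum>l\<in>R. D (g l ^ e l) * (\<Prod>l'\<in>L - {l}. g l' ^ e l'))"
    unfolding derivation_prod[OF D fin]
    by (rule sum.mono_neutral_right[OF fin R]) (simp add: power D0)
  have "D (g l ^ e l) * (\<Prod>l'\<in>L - {l}. g l' ^ e l') = (\<Prod>l\<in>L. g l ^ (if l \<in> R then e l - 1 else e l)) *
    (of_nat (e l) * (D (g l) * (\<Prod>l'\<in>R - {l}. g l')))" if l: "l \<in> R" for l
  proof -
    \<comment> \<open>One copy of each factor in \<open>R\<close> is split off. The lowered powers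
      go into the common cofactor, the copies make up the product over
      \<open>R - {l}\<close>.\<close>
    have "g l' ^ e l' = g l' ^ (if l' \<in> R then e l' - 1 else e l') * (if l' \<in> R then g l' else 1)" for l'
      using e[of l'] by (cases "e l'") auto
    hence "(\<Prod>l'\<in>L - {l}. g l' ^ e l') = (\<Prod>l'\<in>L - {l}. g l' ^ (if l' \<in> R then e l' - 1 else e l')) *
        (\<Prod>l'\<in>L - {l}. if l' \<in> R then g l' else 1)"
      unfolding prod.distrib[symmetric] by (intro prod.cong refl)
    also have "(\<Prod>l'\<in>L - {l}. if l' \<in> R then g l' else 1) = (\<Prod>l'\<in>R - {l}. g l')"
      using fin R by (intro prod.mono_neutral_cong_right) auto
    finally have 2: "(\<Prod>l'\<in>L - {l}. g l' ^ e l') =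
      (\<Prod>l'\<in>L - {l}. g l' ^ (if l' \<in> R then e l' - 1 else e l')) * (\<Prod>l'\<in>R - {l}. g l')" .
    have 3: "(\<Prod>l\<in>L. g l ^ (if l \<in> R then e l - 1 else e l)) =
      g l ^ (e l - 1) * (\<Prod>l'\<in>L - {l}. g l' ^ (if l' \<in> R then e l' - 1 else e l'))"
      using prod.remove[OF fin, of l "\<lambda>l. g l ^ (if l \<in> R then e l - 1 else e l)"] l R by auto
    show ?thesis unfolding 2 3 power by (simp add: algebra_simps)
  qed
  thus ?thesis unfolding 1 sum_distrib_left by (intro sum.cong refl) auto
qed

section \<open>Sparse kernel vectors\<close>

text \<open>Counts monomials over the \<open>fact r\<close> products of the Leibniz formula. The
  bound depends on the row because the rows will belong to products with different numbers of
  affected factors.\<close>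

lemma sparsity_det:
  fixes M :: "('m::comm_monoid_add \<Rightarrow>\<^sub>0 'a::comm_ring_1) mat"
  assumes M: "M \<in> carrier_mat r r" and b: "\<And>i j. i < r \<Longrightarrow> j < r \<Longrightarrow> sparsity (M $$ (i, j)) \<le> b i"
  shows "sparsity (det M) \<le> fact r * (\<Prod>i<r. b i)"
proof -
  have "sparsity (det M) \<le> (\<Sum>p\<in>{p. p permutes {0..<r}}. sparsity (signof p * (\<Prod>i=0..<r. M $$ (i, p i))))"
    unfolding det_def'[OF M] by (rule sparsity_sum)
  also have "\<dots> \<le> (\<Sum>p\<in>{p. p permutes {0..<r}}. \<Prod>i<r. b i)"
  proof (rule sum_mono)
    fix p assume "p \<in> {p. p permutes {0..<r}}"
    hence p: "p i < r" if "i < r" for i using that permutes_in_image[of p "{0..<r}" i] by simp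
    have "sparsity (signof p * (\<Prod>i=0..<r. M $$ (i, p i))) = sparsity (\<Prod>i<r. M $$ (i, p i))"
      by (simp add: sign_def lessThan_atLeast0)
    also have "\<dots> \<le> (\<Prod>i<r. sparsity (M $$ (i, p i)))" by (rule sparsity_prod)
    also have "\<dots> \<le> (\<Prod>i<r. b i)" using b p by (intro prod_mono) auto
    finally show "sparsity (signof p * (\<Prod>i=0..<r. M $$ (i, p i))) \<le> (\<Prod>i<r. b i)" .
  qed
  also have "\<dots> = fact r * (\<Prod>i<r. b i)" by (simp add: card_permutations)
  finally show ?thesis .
qed

text \<open>Cramer's rule, bordering a nonzero minor of maximal size.\<close>

lemma sparse_kernel_vector:
  fixes B :: "'i \<Rightarrow> nat \<Rightarrow> ('m::comm_monoid_add \<Rightarrow>\<^sub>0 'a::comm_ring_1)"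
  assumes fin: "finite I" and card: "card I < t"
    and b: "\<And>i j. i \<in> I \<Longrightarrow> j < t \<Longrightarrow> sparsity (B i j) \<le> b i" and b1: "\<And>i. i \<in> I \<Longrightarrow> 1 \<le> b i"
  obtains p where "\<And>i. i \<in> I \<Longrightarrow> (\<Sum>j<t. B i j * p j) = 0"
    "\<exists>j<t. p j \<noteq> 0" "\<And>j. sparsity (p j) \<le> fact (card I) * (\<Prod>i\<in>I. b i)"
proof -
  define M where "M r u v = mat r r (\<lambda>(x, y). B (u x) (v y))" for r u v
  \<comment> \<open>Some minor of size \<open>r\<close> is nonzero. Injectivity of the row choice
    \<open>u\<close> is automatic, since equal rows kill the determinant.\<close>
  define good where "good r \<longleftrightarrow> (\<exists>u v. u ` {..<r} \<subseteq> I \<and> v ` {..<r} \<subseteq> {..<t} \<and> inj_on v {..<r} \<and> det (M r u v) \<noteq> 0)" for r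
  have inj: "inj_on u {..<r}" if "det (M r u v) \<noteq> 0" for r u v
  proof (rule ccontr)
    assume "\<not> inj_on u {..<r}"
    then obtain x y where "x < r" "y < r" "x \<noteq> y" "u x = u y" by (auto simp: inj_on_def)
    hence "det (M r u v) = 0"
      by (intro det_identical_rows[of _ r x y]) (auto simp: M_def intro!: eq_vecI)
    thus False using that by simp
  qed
  have le: "r \<le> card I" if "good r" for r
  proof -
    obtain u v where "u ` {..<r} \<subseteq> I" "det (M r u v) \<noteq> 0" using \<open>good r\<close> unfolding good_def by blast
    thus ?thesis using card_inj_on_le[OF inj _ fin] by fastforce
  qed
  have "good 0" unfolding good_def M_def by (auto simp: det_def)
  define r where "r = (GREATEST r. good r)"
  have r: "good r" unfolding r_def by (rule GreatestI_nat[of good 0 "card I"]) (use \<open>good 0\<close> le in auto)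
  have max: "\<not> good (Suc r)"
    using Greatest_le_nat[of good "Suc r" "card I"] le unfolding r_def by fastforce
  obtain u v where u: "u ` {..<r} \<subseteq> I" and v: "v ` {..<r} \<subseteq> {..<t}" "inj_on v {..<r}"
    and det: "det (M r u v) \<noteq> 0" using r unfolding good_def by blast
  \<comment> \<open>\<open>card I < t\<close> leaves a column \<open>j0\<close> outside the maximal
    minor. It becomes the last column of the bordered matrices \<open>N i\<close>, whose last row is
    that of \<open>i\<close>.\<close>
  have "card (v ` {..<r}) < card {..<t}" using card_image[OF v(2)] le[OF r] card by simp
  hence "v ` {..<r} \<noteq> {..<t}" by auto
  then obtain j0 where j0: "j0 < t" "j0 \<notin> v ` {..<r}" using v by blast
  define w where "w = v(r := j0)"
  have w: "w ` {..<Suc r} \<subseteq> {..<t}" "inj_on w {..<Suc r}"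
    using v j0 unfolding w_def by (auto simp: inj_on_def lessThan_Suc less_Suc_eq)
  define N where "N i = M (Suc r) (u(r := i)) w" for i
  have N: "N i \<in> carrier_mat (Suc r) (Suc r)" for i unfolding N_def M_def by simp
  \<comment> \<open>Cofactors along the last row do not see that row, so they are the same for every
    \<open>i\<close>; \<open>undefined\<close> is an arbitrary choice.\<close>
  define d where "d y = cofactor (N undefined) r y" for y
  have d: "cofactor (N i) r y = d y" if "y \<le> r" for i y
  proof -
    have "mat_delete (N i) r y = mat_delete (N undefined) r y"
      using that unfolding mat_delete_def N_def M_def by (intro eq_matI) auto
    thus ?thesis unfolding d_def cofactor_def by simp
  qed
  \<comment> \<open>By maximality of \<open>r\<close> the bordered determinants vanish; their
    expansions along the last row will be the kernel equations.\<close>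
  have det0: "det (N i) = 0" if "i \<in> I" for i
  proof (rule ccontr)
    assume "det (N i) \<noteq> 0"
    hence "good (Suc r)" unfolding good_def N_def
      by (intro exI[of _ "u(r := i)"] exI[of _ w]) (use u w that in \<open>auto simp: lessThan_Suc\<close>)
    thus False using max by simp
  qed
  define p where "p j = (if j \<in> w ` {..<Suc r} then d (inv_into {..<Suc r} w j) else 0)" for j
  have pw: "p (w y) = d y" if "y < Suc r" for y
    using that inv_into_f_f[OF w(2)] unfolding p_def by simp
  have bound: "sparsity (d y) \<le> fact (card I) * (\<Prod>i\<in>I. b i)" if "y \<le> r" for y
  proof -
    have "sparsity (d y) = sparsity (det (mat_delete (N undefined) r y))"
      unfolding d_def cofactor_def by (cases "even (r + y)") simp_all
    also have "\<dots> \<le> fact r * (\<Prod>x<r. b (u x))"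
    proof (rule sparsity_det)
      show "mat_delete (N undefined) r y \<in> carrier_mat r r"
        using mat_delete_carrier[OF N] by simp
      fix x z assume xz: "x < r" "z < r"
      have "mat_delete (N undefined) r y $$ (x, z) = B (u x) (w (if z < y then z else Suc z))"
        using xz that unfolding mat_delete_def N_def M_def by auto
      moreover have "w (if z < y then z else Suc z) < t" using w(1) xz by (auto simp: image_subset_iff)
      ultimately show "sparsity (mat_delete (N undefined) r y $$ (x, z)) \<le> b (u x)"
        using b u xz by auto
    qed
    also have "(\<Prod>x<r. b (u x)) = (\<Prod>i\<in>u ` {..<r}. b i)"
      using inj[OF det] by (simp add: prod.reindex)
    \<comment> \<open>Rows outside the minor can only enlarge the product, since
      \<open>1 \<le> b i\<close>.\<close>
    also have "\<dots> = 1 * (\<Prod>i\<in>u ` {..<r}. b i)" by simp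
    also have "\<dots> \<le> (\<Prod>i\<in>I - u ` {..<r}. b i) * (\<Prod>i\<in>u ` {..<r}. b i)"
      by (intro mult_le_mono1 prod_ge_1) (use b1 in auto)
    also have "\<dots> = (\<Prod>i\<in>I. b i)" by (rule prod.subset_diff[OF u fin, symmetric])
    finally show ?thesis using fact_mono_nat[OF le[OF r]] by (meson mult_le_mono order_trans order_refl)
  qed
  show ?thesis
  proof (rule that)
    fix i assume i: "i \<in> I"
    have "(\<Sum>j<t. B i j * p j) = (\<Sum>j\<in>w ` {..<Suc r}. B i j * p j)"
      by (rule sum.mono_neutral_right) (use w in \<open>auto simp: p_def\<close>)
    also have "\<dots> = (\<Sum>y<Suc r. B i (w y) * d y)"
      using pw by (subst sum.reindex[OF w(2)]) (simp add: o_def)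
    also have "\<dots> = (\<Sum>y<Suc r. N i $$ (r, y) * cofactor (N i) r y)"
    proof (rule sum.cong[OF refl])
      fix y assume "y \<in> {..<Suc r}"
      hence "N i $$ (r, y) = B i (w y)" "cofactor (N i) r y = d y"
        using d[of y i] by (simp_all add: N_def M_def)
      thus "B i (w y) * d y = N i $$ (r, y) * cofactor (N i) r y" by simp
    qed
    also have "\<dots> = det (N i)" by (rule laplace_expansion_row[OF N, symmetric]) simp
    finally show "(\<Sum>j<t. B i j * p j) = 0" using det0[OF i] by simp
  next
    \<comment> \<open>The entry of the kernel vector at \<open>j0\<close> is the maximal minor
      itself, hence nonzero.\<close>
    have "mat_delete (N undefined) r r = M r u v"
      unfolding mat_delete_def N_def M_def w_def by (intro eq_matI) auto
    hence "d r = det (M r u v)" unfolding d_def cofactor_def by simp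
    hence "p j0 \<noteq> 0" using det pw[of r] by (simp add: w_def)
    thus "\<exists>j<t. p j \<noteq> 0" using j0 by blast
  next
    fix j
    show "sparsity (p j) \<le> fact (card I) * (\<Prod>i\<in>I. b i)"
    proof (cases "j \<in> w ` {..<Suc r}")
      case True
      then obtain y where "j = w y" "y \<le> r" by (auto simp: less_Suc_eq_le)
      thus ?thesis using bound pw by simp
    qed (simp add: p_def)
  qed
qed

section \<open>Matching polynomials\<close>

definition edge_monomial :: "'e set \<Rightarrow> 'e monomial" where
  "edge_monomial E = (\<Sum>e\<in>E. Poly_Mapping.single e 1)"

text \<open>The common shape of an immanant and its minors; arbitrary coefficients make the class
  closed under differentiation by entries.\<close>

definition matching_poly ::
  "'b set \<Rightarrow> 'b set \<Rightarrow> (('b \<times> 'b) set \<Rightarrow> 'a::comm_semiring_1) \<Rightarrow> ('b \<times> 'b, 'a) mpoly" where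
  "matching_poly X Y c = (\<Sum>E\<in>matchings X Y. Poly_Mapping.single (edge_monomial E) (c E))"

lemma lookup_edge_monomial:
  "finite E \<Longrightarrow> Poly_Mapping.lookup (edge_monomial E) e = of_bool (e \<in> E)"
  unfolding edge_monomial_def by (simp add: lookup_sum lookup_single when_def of_bool_def)

lemma finite_matching: "E \<in> matchings X Y \<Longrightarrow> finite X \<Longrightarrow> finite Y \<Longrightarrow> finite E"
  using matchings_subset[of E X Y] finite_subset[of E "X \<times> Y"] by simp

text \<open>Matching monomials are multilinear, so exactly the matchings through
  \<open>(r, c)\<close> survive and lose that edge. Coefficients are only relabelled, so nonzero
  ones stay nonzero.\<close>

lemma pderivative_matching_poly:
  assumes "finite X" "finite Y" "r \<in> X" "c \<in> Y"
  shows "pderivative (r, c) (matching_poly X Y a) =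
    matching_poly (X - {r}) (Y - {c}) (\<lambda>E. a (insert (r, c) E))"
proof -
  let ?g = "\<lambda>E. Poly_Mapping.single (edge_monomial E - Poly_Mapping.single (r, c) 1)
    (of_bool ((r, c) \<in> E) * a E)"
  have "pderivative (r, c) (matching_poly X Y a) = (\<Sum>E\<in>matchings X Y. ?g E)"
    unfolding matching_poly_def pderivative_sum
    by (intro sum.cong refl)
       (use assms in \<open>simp add: pderivative_single lookup_edge_monomial finite_matching[of _ X Y]\<close>)
  also have "\<dots> = (\<Sum>E\<in>{E \<in> matchings X Y. (r, c) \<in> E}. ?g E)"
    using assms by (intro sum.mono_neutral_right) (auto simp: finite_matchings)
  also have "\<dots> = (\<Sum>E\<in>matchings (X - {r}) (Y - {c}). ?g (insert (r, c) E))"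
    by (rule sum.reindex_bij_betw[OF bij_betw_matchings_insert[OF assms(3,4)], symmetric])
  also have "\<dots> = matching_poly (X - {r}) (Y - {c}) (\<lambda>E. a (insert (r, c) E))"
    unfolding matching_poly_def
  proof (rule sum.cong[OF refl])
    fix E assume E: "E \<in> matchings (X - {r}) (Y - {c})"
    have "finite E" using finite_matching[OF E] assms by simp
    hence "edge_monomial (insert (r, c) E) - Poly_Mapping.single (r, c) 1 = edge_monomial E"
      using matchings_notin[OF E] unfolding edge_monomial_def by simp
    thus "?g (insert (r, c) E) = Poly_Mapping.single (edge_monomial E) (a (insert (r, c) E))" by simp
  qed
  finally show ?thesis .
qed

section \<open>Coefficients at integer exponent vectors\<close>

definition int_exponents :: "'v monomial \<Rightarrow> 'v \<Rightarrow> int" where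
  "int_exponents m v = int (Poly_Mapping.lookup m v)"

text \<open>Exponents are allowed to be negative here so that exponent vectors may be subtracted.\<close>

definition int_coeff :: "('v, 'a::zero) mpoly \<Rightarrow> ('v \<Rightarrow> int) \<Rightarrow> 'a" where
  "int_coeff p m = (if m \<in> range int_exponents then Poly_Mapping.lookup p (inv_into UNIV int_exponents m) else 0)"

lemma inj_int_exponents: "inj int_exponents"
  by (rule injI) (auto intro!: poly_mapping_eqI simp: int_exponents_def fun_eq_iff)

lemma int_coeff_exponents [simp]: "int_coeff p (int_exponents m) = Poly_Mapping.lookup p m"
  by (simp add: int_coeff_def inv_f_f[OF inj_int_exponents])

lemma int_coeff_add: "int_coeff (p + q) m = int_coeff p m + int_coeff q m"
  by (simp add: int_coeff_def lookup_add)

lemma int_coeff_0 [simp]: "int_coeff 0 m = 0"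
  by (simp add: int_coeff_def)

lemma int_coeff_sum: "int_coeff (\<Sum>i\<in>I. p i) m = (\<Sum>i\<in>I. int_coeff (p i) m)"
  by (induction I rule: infinite_finite_induct) (simp_all add: int_coeff_add)

lemma int_coeff_single: "int_coeff (Poly_Mapping.single n a) m = (if m = int_exponents n then a else 0)"
  by (auto simp: int_coeff_def lookup_single when_def inv_f_f[OF inj_int_exponents])

lemma int_coeff_mult_single:
  "int_coeff (p * Poly_Mapping.single n a) m = a * int_coeff p (\<lambda>v. m v - int_exponents n v)"
  for p :: "('v, 'a::comm_semiring_1) mpoly"
proof (induction p rule: poly_mapping_add_induct)
  case (single l b)
  have "m = int_exponents (l + n) \<longleftrightarrow> (\<lambda>v. m v - int_exponents n v) = int_exponents l"
    by (auto simp: int_exponents_def fun_eq_iff lookup_add algebra_simps)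
  thus ?case by (simp add: mult_single int_coeff_single algebra_simps)
qed (simp add: int_coeff_add algebra_simps)

lemma support_int_coeff:
  "support S (\<lambda>i. int_coeff (p i)) = (\<lambda>(i, m). (i, int_exponents m)) ` (SIGMA i:S. Poly_Mapping.keys (p i))"
proof (intro equalityI subsetI)
  fix x assume "x \<in> support S (\<lambda>i. int_coeff (p i))"
  then obtain i m where x: "x = (i, m)" "i \<in> S" "int_coeff (p i) m \<noteq> 0" by (auto simp: support_def)
  then obtain n where n: "m = int_exponents n" by (auto simp: int_coeff_def split: if_splits)
  have "n \<in> Poly_Mapping.keys (p i)" using x n by (simp add: in_keys_iff)
  thus "x \<in> (\<lambda>(i, m). (i, int_exponents m)) ` (SIGMA i:S. Poly_Mapping.keys (p i))"
    using x n by (auto intro!: image_eqI[of _ _ "(i, n)"])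
qed (auto simp: support_def in_keys_iff)

text \<open>Multiplying by the monomial of \<open>E\<close> shifts coefficients by the indicator of
  \<open>E\<close>, so comparing coefficients in the relation is precisely \<open>syzygy\<close>,
  and \<open>card_support_syzygy\<close> applies.\<close>

lemma sparsity_relation:
  fixes p :: "'b \<Rightarrow> ('b \<times> 'b, 'a::field) mpoly"
  assumes fin: "finite A" "finite B" "finite S"
    and disj: "A \<inter> S = {}" "B \<inter> S = {}" and card: "card A = card B" "card A = card S + q"
    and nz: "\<And>i E. i \<in> S \<Longrightarrow> E \<in> matchings (A \<union> S - {i}) (B \<union> S - {i}) \<Longrightarrow> c i E \<noteq> 0"
    and rel: "(\<Sum>i\<in>S. p i * matching_poly (A \<union> S - {i}) (B \<union> S - {i}) (c i)) = 0"
    and ne: "i \<in> S" "p i \<noteq> 0"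
  shows "2 ^ q \<le> (\<Sum>i\<in>S. sparsity (p i))"
proof -
  let ?f = "\<lambda>i. int_coeff (p i)"
  have "syzygy S A B c ?f"
    unfolding syzygy_def
  proof
    fix m
    have "(\<Sum>i\<in>S. \<Sum>E\<in>matchings (A \<union> S - {i}) (B \<union> S - {i}). c i E * ?f i (\<lambda>e. m e - of_bool (e \<in> E)))
        = int_coeff (\<Sum>i\<in>S. p i * matching_poly (A \<union> S - {i}) (B \<union> S - {i}) (c i)) m"
      unfolding matching_poly_def sum_distrib_left int_coeff_sum int_coeff_mult_single
    proof (intro sum.cong refl)
      fix i E assume "E \<in> matchings (A \<union> S - {i}) (B \<union> S - {i})"
      hence "finite E" using fin by (auto dest: finite_matching)
      thus "c i E * ?f i (\<lambda>e. m e - of_bool (e \<in> E)) = c i E * ?f i (\<lambda>v. m v - int_exponents (edge_monomial E) v)"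
        by (simp add: int_exponents_def lookup_edge_monomial)
    qed
    thus "(\<Sum>i\<in>S. \<Sum>E\<in>matchings (A \<union> S - {i}) (B \<union> S - {i}). c i E * ?f i (\<lambda>e. m e - of_bool (e \<in> E))) = 0"
      unfolding rel by simp
  qed
  moreover have "finite (support S ?f)" unfolding support_int_coeff using fin by auto
  moreover have "support S ?f \<noteq> {}"
  proof -
    obtain m where "m \<in> Poly_Mapping.keys (p i)" using ne(2) by (metis keys_eq_empty ex_in_conv)
    thus ?thesis unfolding support_int_coeff using ne(1) by blast
  qed
  ultimately have "2 ^ q \<le> card (support S ?f)"
    using card_support_syzygy[of S A B c ?f q] fin disj card nz by blast
  also have "\<dots> = card (SIGMA i:S. Poly_Mapping.keys (p i))"
    unfolding support_int_coeff using inj_int_exponents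
    by (intro card_image) (auto simp: inj_on_def)
  also have "\<dots> = (\<Sum>i\<in>S. sparsity (p i))" using fin by (simp add: sparsity_def)
  finally show ?thesis .
qed

section \<open>The immanant as a matching polynomial\<close>

lemma bij_betw_graph_Sym:
  "bij_betw (\<lambda>\<sigma>. (\<lambda>i. (i, \<sigma> i)) ` {..<n}) (Sym n) (matchings {..<n} {..<n})"
proof (rule bij_betw_imageI)
  show "inj_on (\<lambda>\<sigma>. (\<lambda>i. (i, \<sigma> i)) ` {..<n}) (Sym n)"
  proof (rule inj_onI)
    fix \<sigma> \<tau> assume s: "\<sigma> \<in> Sym n" "\<tau> \<in> Sym n" and eq: "(\<lambda>i. (i, \<sigma> i)) ` {..<n} = (\<lambda>i. (i, \<tau> i)) ` {..<n}"
    show "\<sigma> = \<tau>"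
    proof
      fix i
      show "\<sigma> i = \<tau> i"
      proof (cases "i < n")
        case True
        hence "(i, \<sigma> i) \<in> (\<lambda>i. (i, \<tau> i)) ` {..<n}" unfolding eq[symmetric] by simp
        thus ?thesis by auto
      next
        \<comment> \<open>Elements of \<open>Sym n\<close> are the identity beyond \<open>n\<close>,
          which the graph does not record.\<close>
        case False
        thus ?thesis using s by (simp add: Sym_def permutes_def)
      qed
    qed
  qed
  show "(\<lambda>\<sigma>. (\<lambda>i. (i, \<sigma> i)) ` {..<n}) ` Sym n = matchings {..<n} {..<n}"
  proof (intro equalityI subsetI)
    fix E assume "E \<in> (\<lambda>\<sigma>. (\<lambda>i. (i, \<sigma> i)) ` {..<n}) ` Sym n"
    then obtain \<sigma> where s: "\<sigma> permutes {..<n}" and E: "E = (\<lambda>i. (i, \<sigma> i)) ` {..<n}"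
      by (auto simp: Sym_def)
    have mem: "(i, j) \<in> E \<longleftrightarrow> i < n \<and> j = \<sigma> i" for i j unfolding E by auto
    show "E \<in> matchings {..<n} {..<n}"
      unfolding matchings_def
    proof (intro CollectI conjI ballI)
      show "E \<subseteq> {..<n} \<times> {..<n}" unfolding E using permutes_in_image[OF s] by auto
      show "\<exists>!j. (i, j) \<in> E" if "i \<in> {..<n}" for i using that by (simp add: mem)
      show "\<exists>!i. (i, j) \<in> E" if "j \<in> {..<n}" for j
      proof (rule ex1I[of _ "inv_into UNIV \<sigma> j"])
        show "(inv_into UNIV \<sigma> j, j) \<in> E"
          using that permutes_in_image[OF permutes_inv[OF s], of j] permutes_inverses[OF s] by (simp add: mem)
        show "i = inv_into UNIV \<sigma> j" if "(i, j) \<in> E" for i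
          using that permutes_inverses[OF s] by (simp add: mem)
      qed
    qed
  next
    fix E assume E: "E \<in> matchings {..<n} {..<n}"
    define \<sigma> where "\<sigma> i = (if i < n then THE j. (i, j) \<in> E else i)" for i
    have r1: "\<exists>!j. (i, j) \<in> E" if "i < n" for i using E that by (simp add: matchings_def)
    have c1: "\<exists>!i. (i, j) \<in> E" if "j < n" for j using E that by (simp add: matchings_def)
    have sub: "i < n" "j < n" if "(i, j) \<in> E" for i j using matchings_subset[OF E] that by auto
    have \<sigma>: "(i, \<sigma> i) \<in> E" if "i < n" for i using theI'[OF r1[OF that]] that by (simp add: \<sigma>_def)
    have "bij_betw \<sigma> {..<n} {..<n}"
    proof (rule bij_betw_imageI)
      show "inj_on \<sigma> {..<n}"
      proof (rule inj_onI)
        fix i j assume a: "i \<in> {..<n}" "j \<in> {..<n}" "\<sigma> i = \<sigma> j"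
        have "(i, \<sigma> i) \<in> E" "(j, \<sigma> i) \<in> E" using \<sigma>[of i] \<sigma>[of j] a by auto
        thus "i = j" using c1[of "\<sigma> i"] sub by blast
      qed
      show "\<sigma> ` {..<n} = {..<n}"
      proof (intro equalityI subsetI)
        fix j assume "j \<in> {..<n}"
        then obtain i where i: "(i, j) \<in> E" using c1 by blast
        hence "\<sigma> i = j" using r1[of i] \<sigma>[of i] sub[OF i] by blast
        thus "j \<in> \<sigma> ` {..<n}" using sub[OF i] by blast
      qed (use \<sigma> sub in blast)
    qed
    hence "\<sigma> permutes {..<n}" by (rule bij_imp_permutes) (simp add: \<sigma>_def)
    moreover have "(\<lambda>i. (i, \<sigma> i)) ` {..<n} = E"
    proof (intro equalityI subsetI)
      fix e assume e: "e \<in> E"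
      obtain i j where ij: "e = (i, j)" by fastforce
      have "i < n" "j = \<sigma> i" using r1[of i] \<sigma>[of i] sub[of i j] e ij by blast+
      thus "e \<in> (\<lambda>i. (i, \<sigma> i)) ` {..<n}" using ij by blast
    qed (use \<sigma> in auto)
    ultimately show "E \<in> (\<lambda>\<sigma>. (\<lambda>i. (i, \<sigma> i)) ` {..<n}) ` Sym n" by (force simp: Sym_def)
  qed
qed

text \<open>A matching carries the character value of the permutation whose graph it is. The lower
  bound draws on the character through the nonvanishing of these coefficients.\<close>

lemma generic_immanant_matching_poly:
  assumes nz: "\<And>\<sigma>. \<sigma> \<in> Sym n \<Longrightarrow> \<phi> (\<chi> \<sigma>) \<noteq> 0"
  shows "\<exists>c. generic_immanant n \<chi> \<phi> = matching_poly {..<n} {..<n} c \<and>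
    (\<forall>E\<in>matchings {..<n} {..<n}. c E \<noteq> 0)"
proof -
  let ?g = "\<lambda>\<sigma>. (\<lambda>i. (i, \<sigma> i)) ` {..<n}"
  define h where "h = inv_into (Sym n) ?g"
  note bij = bij_betw_graph_Sym[of n]
  have h: "h (?g \<sigma>) = \<sigma>" if "\<sigma> \<in> Sym n" for \<sigma>
    unfolding h_def using bij_betw_inv_into_left[OF bij that] .
  define c where "c E = \<phi> (\<chi> (h E))" for E
  have prod: "(\<Prod>i<l. Var (i, \<sigma> i) :: (nat \<times> nat, 'a) mpoly)
      = Poly_Mapping.single (edge_monomial ((\<lambda>i. (i, \<sigma> i)) ` {..<l})) 1" for \<sigma> l
  proof (induction l)
    case (Suc l)
    have "edge_monomial ((\<lambda>i. (i, \<sigma> i)) ` {..<Suc l}) =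
        Poly_Mapping.single (l, \<sigma> l) 1 + edge_monomial ((\<lambda>i. (i, \<sigma> i)) ` {..<l})"
      unfolding edge_monomial_def lessThan_Suc image_insert by (subst sum.insert) auto
    thus ?case using Suc by (simp add: Var_def mult_single add.commute)
  qed (simp add: edge_monomial_def)
  have "generic_immanant n \<chi> \<phi> = (\<Sum>\<sigma>\<in>Sym n. Poly_Mapping.single (edge_monomial (?g \<sigma>)) (c (?g \<sigma>)))"
    unfolding generic_immanant_def immanant_def prod
    by (intro sum.cong refl) (simp add: Const_def mult_single c_def h)
  also have "\<dots> = matching_poly {..<n} {..<n} c"
    unfolding matching_poly_def by (rule sum.reindex_bij_betw[OF bij])
  finally have "generic_immanant n \<chi> \<phi> = matching_poly {..<n} {..<n} c" .
  moreover have "c E \<noteq> 0" if "E \<in> matchings {..<n} {..<n}" for E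
    using nz bij_betwE[OF bij_betw_inv_into[OF bij]] that unfolding c_def h_def by blast
  ultimately show ?thesis by blast
qed

section \<open>Sums of products of powers of sparse polynomials\<close>

text \<open>Each summand is a scalar times the derivative of one factor, with at most
  \<open>s\<close> monomials, times the other \<open>card R - 1\<close> factors.\<close>

lemma sparsity_cofactor:
  fixes g :: "'l \<Rightarrow> ('v, 'a::comm_ring_1) mpoly"
  assumes "finite R" and s: "\<And>l. l \<in> R \<Longrightarrow> sparsity (g l) \<le> s"
  shows "sparsity (\<Sum>l\<in>R. of_nat (e l) * (pderivative v (g l) * (\<Prod>l'\<in>R - {l}. g l')))
    \<le> card R * s ^ card R"
proof -
  have "sparsity (of_nat (e l) * (pderivative v (g l) * (\<Prod>l'\<in>R - {l}. g l'))) \<le> s ^ card R"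
    if l: "l \<in> R" for l
  proof -
    have "sparsity (of_nat (e l) * (pderivative v (g l) * (\<Prod>l'\<in>R - {l}. g l')))
        \<le> sparsity (pderivative v (g l)) * sparsity (\<Prod>l'\<in>R - {l}. g l')"
      by (rule order_trans[OF sparsity_of_nat_mult sparsity_mult])
    also have "\<dots> \<le> s * s ^ card (R - {l})"
      using s l by (intro mult_le_mono order_trans[OF sparsity_pderivative] sparsity_prod_le_power) auto
    also have "\<dots> = s ^ card R" using card.remove[OF assms(1) l] by simp
    finally show ?thesis .
  qed
  hence "(\<Sum>l\<in>R. sparsity (of_nat (e l) * (pderivative v (g l) * (\<Prod>l'\<in>R - {l}. g l'))))
      \<le> (\<Sum>l\<in>R. s ^ card R)" by (rule sum_mono)
  thus ?thesis using order_trans[OF sparsity_sum] by fastforce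
qed

lemma Suc_le_power:
  fixes k s :: nat
  assumes "2 \<le> s"
  shows "Suc k \<le> s ^ k"
  by (rule order_trans[OF Suc_leI[OF less_exp] power_mono[OF assms]]) simp

lemma fact_Suc_le: "fact (Suc k) \<le> (2::nat) ^ (k * k)"
proof (induction k)
  case (Suc k)
  have "Suc (Suc k) \<le> 2 ^ Suc k" by (rule Suc_leI) (rule less_exp)
  \<comment> \<open>\<open>2 * k + 1\<close> is the step from \<open>k * k\<close> to the next
    square.\<close>
  also have "\<dots> \<le> 2 ^ (2 * k + 1)" by (intro power_increasing) auto
  finally have "Suc (Suc k) * fact (Suc k) \<le> 2 ^ (2 * k + 1) * (2::nat) ^ (k * k)"
    using Suc.IH by (rule mult_le_mono)
  also have "\<dots> = 2 ^ (Suc k * Suc k)" by (simp flip: power_add)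
  finally show ?case by (simp only: fact_Suc of_nat_id)
qed simp

text \<open>The linear system has at most \<open>k\<close> rows, one for each product involving a
  chosen variable \<open>x\<close>, and \<open>k + 1\<close> columns, one for each further diagonal
  variable. A sparse kernel vector turns it into a relation between minors, whose size is bounded
  from both sides.\<close>

lemma sum_of_products_lower_bound:
  fixes g :: "'i \<Rightarrow> 'l \<Rightarrow> (nat \<times> nat, 'a::field) mpoly"
  assumes finI: "finite I" and finL: "\<And>i. i \<in> I \<Longrightarrow> finite (L i)"
    and e: "\<And>i l. i \<in> I \<Longrightarrow> l \<in> L i \<Longrightarrow> 1 \<le> e i l"
    and sparse: "\<And>i l. i \<in> I \<Longrightarrow> l \<in> L i \<Longrightarrow> sparsity (g i l) \<le> s"
    and s2: "2 \<le> s" and k1: "1 \<le> k"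
    and occ: "\<And>v. (\<Sum>i\<in>I. card {l \<in> L i. v \<in> vars (g i l)}) \<le> k"
    and f: "(\<Sum>i\<in>I. \<Prod>l\<in>L i. g i l ^ e i l) = matching_poly {..<n} {..<n} c"
    and c: "\<And>E. E \<in> matchings {..<n} {..<n} \<Longrightarrow> c E \<noteq> 0"
    and n: "n = Suc (2 * (k + 1) + q)"
  shows "2 ^ q \<le> s ^ (7 * k\<^sup>2)"
proof -
  \<comment> \<open>Of the \<open>n\<close> indices the last is spent on \<open>x\<close> and
    \<open>k + 1\<close> on the block \<open>S\<close>. The remaining \<open>k + 1 + q\<close> form
    \<open>A\<close>, so the relation has surplus \<open>q\<close>.\<close>
  define N where "N = 2 * (k + 1) + q"
  define S where "S = {..<k + 1}"
  define A where "A = {k + 1..<N}"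
  have N: "n = Suc N" "A \<union> S = {..<N}" "A \<inter> S = {}" "finite A" "finite S" "card S = k + 1"
    "card A = card S + q"
    using n by (auto simp: N_def A_def S_def)
  have s1: "1 \<le> s" using s2 by simp

  define x where "x = (N, N)"
  \<comment> \<open>Only products with a factor containing \<open>x\<close> survive the first
    derivative. Each uses up at least one of the \<open>k\<close> occurrences of \<open>x\<close>,
    so \<open>J\<close> has at most \<open>k\<close> elements.\<close>
  define R where "R i = {l \<in> L i. x \<in> vars (g i l)}" for i
  define J where "J = {i \<in> I. R i \<noteq> {}}"
  have J: "J \<subseteq> I" "finite J" using finI by (auto simp: J_def)
  have finR: "finite (R i)" if "i \<in> I" for i using finL[OF that] by (simp add: R_def)
  have sum_R: "(\<Sum>i\<in>I. card (R i)) \<le> k" using occ[of x] by (simp add: R_def)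
  have card_R: "card (R i) \<le> k" if "i \<in> I" for i
    using member_le_sum[of i I "\<lambda>i. card (R i)"] that finI sum_R by simp
  have "card J = (\<Sum>i\<in>J. 1)" by simp
  also have "\<dots> \<le> (\<Sum>i\<in>J. card (R i))"
    using finR by (intro sum_mono) (auto simp: J_def Suc_le_eq card_gt_0_iff)
  also have "\<dots> \<le> (\<Sum>i\<in>I. card (R i))" using J finI by (intro sum_mono2) auto
  finally have card_J: "card J \<le> k" using sum_R by simp

  \<comment> \<open>The derivative of the \<open>i\<close>-th product is \<open>V i * P i\<close>,
    where \<open>V i\<close> is again a product of powers and \<open>P i\<close> is sparse.\<close>
  define e' where "e' i l = (if l \<in> R i then e i l - 1 else e i l)" for i l
  define V where "V i = (\<Prod>l\<in>L i. g i l ^ e' i l)" for i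
  define P where "P i = (\<Sum>l\<in>R i. of_nat (e i l) *
    (pderivative x (g i l) * (\<Prod>l'\<in>R i - {l}. g i l')))" for i
  have Dx: "pderivative x (\<Prod>l\<in>L i. g i l ^ e i l) = V i * P i" if i: "i \<in> I" for i
    unfolding V_def P_def e'_def
    by (rule derivation_prod_powers[OF pderivative_mult finL[OF i]])
       (use e[OF i] pderivative_eq_0 in \<open>auto simp: R_def\<close>)
  have sP: "sparsity (P i) \<le> s ^ (2 * k)" if i: "i \<in> I" for i
  proof -
    have "sparsity (P i) \<le> card (R i) * s ^ card (R i)"
      unfolding P_def by (rule sparsity_cofactor[OF finR[OF i]]) (use sparse[OF i] in \<open>auto simp: R_def\<close>)
    also have "\<dots> \<le> s ^ k * s ^ k"
      using card_R[OF i] Suc_leD[OF Suc_le_power[OF s2, of k]] s1 by (intro mult_le_mono power_increasing) auto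
    finally show ?thesis by (simp add: mult_2 power_add)
  qed

  \<comment> \<open>Factors whose exponent dropped to 0 are removed, so that the power rule applies
    a second time. \<open>R' i\<close> collects the factors touched by any of the variables
    \<open>(j, j)\<close>, which makes the cofactor \<open>W i\<close> independent of
    \<open>j\<close>.\<close>
  define L' where "L' i = {l \<in> L i. 1 \<le> e' i l}" for i
  define R' where "R' i = {l \<in> L' i. \<exists>j\<in>S. (j, j) \<in> vars (g i l)}" for i
  have finL': "finite (L' i)" "finite (R' i)" if "i \<in> I" for i
    using finL[OF that] by (simp_all add: L'_def R'_def)
  have V: "V i = (\<Prod>l\<in>L' i. g i l ^ e' i l)" if "i \<in> I" for i
    unfolding V_def L'_def using finL[OF that] by (intro prod.mono_neutral_right) (auto simp: not_less_eq_eq)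
  define W where "W i = (\<Prod>l\<in>L' i. g i l ^ (if l \<in> R' i then e' i l - 1 else e' i l))" for i
  define Q where "Q i = (\<Prod>l\<in>R' i. g i l)" for i
  define C where "C i j = (\<Sum>l\<in>R' i. of_nat (e' i l) *
    (pderivative (j, j) (g i l) * (\<Prod>l'\<in>R' i - {l}. g i l')))" for i and j :: nat
  \<comment> \<open>From the product rule for \<open>V i * P i\<close> and
    \<open>V i = W i * Q i\<close>, with \<open>W i\<close> taken out.\<close>
  define B where "B i j = Q i * pderivative (j, j) (P i) + P i * C i j" for i and j :: nat
  have DV: "pderivative (j, j) (V i) = W i * C i j" if i: "i \<in> I" and j: "j \<in> S" for i j
    unfolding V[OF i] W_def C_def
    by (rule derivation_prod_powers[OF pderivative_mult finL'(1)[OF i]])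
       (use j in \<open>auto simp: R'_def L'_def intro!: pderivative_eq_0\<close>)
  have VW: "V i = W i * Q i" if i: "i \<in> I" for i
  proof -
    have "Q i = (\<Prod>l\<in>L' i. if l \<in> R' i then g i l else 1)"
      unfolding Q_def using finL'[OF i] by (intro prod.mono_neutral_cong_left) (auto simp: R'_def)
    moreover have "g i l ^ e' i l =
        g i l ^ (if l \<in> R' i then e' i l - 1 else e' i l) * (if l \<in> R' i then g i l else 1)"
      if "l \<in> L' i" for l
      using that by (cases "e' i l") (auto simp: L'_def)
    ultimately show ?thesis unfolding V[OF i] W_def by (simp add: prod.distrib[symmetric])
  qed
  have DB: "pderivative (j, j) (V i * P i) = W i * B i j" if i: "i \<in> I" and j: "j \<in> S" for i j
    unfolding pderivative_mult DV[OF i j] B_def by (simp add: VW[OF i] algebra_simps)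

  \<comment> \<open>The exponent has \<open>2 * k\<close> for \<open>P i\<close>,
    \<open>card (R' i)\<close> for the products over \<open>R' i\<close>, and as much again to
    absorb the factor \<open>Suc (card (R' i))\<close>.\<close>
  define b where "b i = s ^ (2 * k + 2 * card (R' i))" for i
  have sB: "sparsity (B i j) \<le> b i" if i: "i \<in> I" for i j
  proof -
    let ?r = "card (R' i)"
    have sg: "sparsity (g i l) \<le> s" if "l \<in> R' i" for l
      using that sparse[OF i] by (auto simp: R'_def L'_def)
    have "sparsity (B i j) \<le> sparsity (Q i * pderivative (j, j) (P i)) + sparsity (P i * C i j)"
      unfolding B_def by (rule sparsity_add)
    also have "\<dots> \<le> sparsity (Q i) * sparsity (pderivative (j, j) (P i)) + sparsity (P i) * sparsity (C i j)"
      by (intro add_mono sparsity_mult)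
    also have "\<dots> \<le> s ^ ?r * s ^ (2 * k) + s ^ (2 * k) * (?r * s ^ ?r)"
      unfolding Q_def C_def
      by (intro add_mono mult_le_mono sparsity_prod_le_power sg sP[OF i]
          order_trans[OF sparsity_pderivative] sparsity_cofactor finL'(2)[OF i])
    also have "\<dots> = Suc ?r * (s ^ ?r * s ^ (2 * k))" by simp
    also have "\<dots> \<le> s ^ ?r * (s ^ ?r * s ^ (2 * k))" by (rule mult_le_mono1[OF Suc_le_power[OF s2]])
    also have "\<dots> = b i" unfolding b_def by (simp add: power_add mult_2)
    finally show ?thesis .
  qed
  \<comment> \<open>Each of the \<open>k + 1\<close> variables of the block occurs in at most
    \<open>k\<close> factors, over all products together.\<close>
  have sum_R': "(\<Sum>i\<in>J. card (R' i)) \<le> (k + 1) * k"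
  proof -
    have "card (R' i) \<le> (\<Sum>j\<in>S. card {l \<in> L i. (j, j) \<in> vars (g i l)})" if "i \<in> I" for i
    proof -
      have "card (R' i) \<le> card (\<Union>j\<in>S. {l \<in> L i. (j, j) \<in> vars (g i l)})"
        using finL[OF that] N by (intro card_mono) (auto simp: R'_def L'_def)
      also have "\<dots> \<le> (\<Sum>j\<in>S. card {l \<in> L i. (j, j) \<in> vars (g i l)})"
        using N by (intro card_UN_le) auto
      finally show ?thesis .
    qed
    hence "(\<Sum>i\<in>J. card (R' i)) \<le> (\<Sum>i\<in>J. \<Sum>j\<in>S. card {l \<in> L i. (j, j) \<in> vars (g i l)})"
      using J by (intro sum_mono) auto
    also have "\<dots> \<le> (\<Sum>i\<in>I. \<Sum>j\<in>S. card {l \<in> L i. (j, j) \<in> vars (g i l)})"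
      using J finI by (intro sum_mono2) auto
    also have "\<dots> = (\<Sum>j\<in>S. \<Sum>i\<in>I. card {l \<in> L i. (j, j) \<in> vars (g i l)})" by (rule sum.swap)
    also have "\<dots> \<le> (\<Sum>j\<in>S. k)" by (intro sum_mono occ)
    finally show ?thesis using N by simp
  qed
  have prod_b: "(\<Prod>i\<in>J. b i) \<le> s ^ (4 * k\<^sup>2 + 2 * k)"
  proof -
    have "(\<Prod>i\<in>J. b i) = s ^ (\<Sum>i\<in>J. 2 * k + 2 * card (R' i))" unfolding b_def by (simp add: power_sum)
    also have "(\<Sum>i\<in>J. 2 * k + 2 * card (R' i)) = card J * (2 * k) + 2 * (\<Sum>i\<in>J. card (R' i))"
      by (simp add: sum.distrib sum_distrib_left)
    also have "s ^ \<dots> \<le> s ^ (k * (2 * k) + 2 * ((k + 1) * k))"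
      using s1 card_J sum_R' by (intro power_increasing add_mono mult_le_mono) auto
    also have "k * (2 * k) + 2 * ((k + 1) * k) = 4 * k\<^sup>2 + 2 * k"
      by (simp add: power2_eq_square algebra_simps)
    finally show ?thesis .
  qed

  obtain p where p0: "\<And>i. i \<in> J \<Longrightarrow> (\<Sum>j<k + 1. B i j * p j) = 0" and pne: "\<exists>j<k + 1. p j \<noteq> 0"
    and sp: "\<And>j. sparsity (p j) \<le> fact (card J) * (\<Prod>i\<in>J. b i)"
    by (rule sparse_kernel_vector[of J "k + 1" B b])
       (use J card_J sB s1 in \<open>auto simp: b_def\<close>)

  \<comment> \<open>Coefficients pass through both derivatives unchanged, once the edges
    \<open>x\<close> and \<open>(j, j)\<close> are put back.\<close>
  define c' where "c' j E = c (insert x (insert (j, j) E))" for j E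
  have "pderivative x (matching_poly {..<n} {..<n} c) = matching_poly ({..<n} - {N}) ({..<n} - {N}) (\<lambda>E. c (insert x E))"
    unfolding x_def by (rule pderivative_matching_poly) (use N in auto)
  moreover have "{..<n} - {N} = {..<N}" using N by auto
  ultimately have "pderivative (j, j) (pderivative x (matching_poly {..<n} {..<n} c))
      = matching_poly ({..<N} - {j}) ({..<N} - {j}) (c' j)" if "j \<in> S" for j
    unfolding c'_def using that N by (subst pderivative_matching_poly[symmetric]) auto
  moreover have "pderivative x (matching_poly {..<n} {..<n} c) = (\<Sum>i\<in>J. V i * P i)"
  proof -
    have "pderivative x (matching_poly {..<n} {..<n} c) = (\<Sum>i\<in>I. V i * P i)"
      unfolding f[symmetric] pderivative_sum using Dx by (intro sum.cong) auto
    also have "\<dots> = (\<Sum>i\<in>J. V i * P i)"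
      using finI J by (intro sum.mono_neutral_right) (auto simp: J_def P_def)
    finally show ?thesis .
  qed
  ultimately have minor: "matching_poly ({..<N} - {j}) ({..<N} - {j}) (c' j) = (\<Sum>i\<in>J. W i * B i j)"
    if "j \<in> S" for j
    using that DB J by (simp add: pderivative_sum subset_iff cong: sum.cong)

  \<comment> \<open>Substituting \<open>minor\<close> and exchanging the sums leaves the kernel
    equations, each multiplied by \<open>W i\<close>.\<close>
  have rel: "(\<Sum>j\<in>S. p j * matching_poly (A \<union> S - {j}) (A \<union> S - {j}) (c' j)) = 0"
  proof -
    have "(\<Sum>j\<in>S. p j * matching_poly (A \<union> S - {j}) (A \<union> S - {j}) (c' j)) =
        (\<Sum>j\<in>S. \<Sum>i\<in>J. W i * (B i j * p j))"
      unfolding N(2) by (intro sum.cong refl) (simp add: minor sum_distrib_left algebra_simps)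
    also have "\<dots> = (\<Sum>i\<in>J. W i * (\<Sum>j\<in>S. B i j * p j))"
      by (subst sum.swap) (simp add: sum_distrib_left)
    also have "\<dots> = 0" using p0 by (intro sum.neutral) (simp add: S_def)
    finally show ?thesis .
  qed
  have nz: "c' j E \<noteq> 0" if j: "j \<in> S" and E: "E \<in> matchings (A \<union> S - {j}) (A \<union> S - {j})" for j E
  proof -
    have "E \<in> matchings ({..<n} - {N} - {j}) ({..<n} - {N} - {j})"
      unfolding \<open>{..<n} - {N} = {..<N}\<close> using E N(2) by simp
    hence "insert (j, j) E \<in> matchings ({..<n} - {N}) ({..<n} - {N})"
      by (rule matchings_insert) (use j N in auto)
    hence "insert x (insert (j, j) E) \<in> matchings {..<n} {..<n}"
      unfolding x_def by (rule matchings_insert) (use N in auto)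
    thus ?thesis unfolding c'_def by (rule c)
  qed
  obtain j0 where j0: "j0 \<in> S" "p j0 \<noteq> 0" using pne by (auto simp: S_def)
  have "2 ^ q \<le> (\<Sum>j\<in>S. sparsity (p j))"
    by (rule sparsity_relation[OF N(4,4,5,3,3) refl N(7) nz rel j0])
  also have "\<dots> \<le> (\<Sum>j\<in>S. fact (card J) * (\<Prod>i\<in>J. b i))" by (intro sum_mono sp)
  \<comment> \<open>\<open>k + 1\<close> and \<open>fact k\<close> combine to a factorial below
    \<open>s ^ k\<^sup>2\<close>. The exponents add up to \<open>5 * k\<^sup>2 + 2 * k\<close>,
    which is at most \<open>7 * k\<^sup>2\<close> as \<open>1 \<le> k\<close>.\<close>
  also have "\<dots> = (k + 1) * fact (card J) * (\<Prod>i\<in>J. b i)" by (simp add: N(6) algebra_simps)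
  also have "\<dots> \<le> (k + 1) * fact k * s ^ (4 * k\<^sup>2 + 2 * k)"
    using fact_mono_nat[OF card_J] prod_b by (intro mult_le_mono) auto
  also have "\<dots> = fact (Suc k) * s ^ (4 * k\<^sup>2 + 2 * k)" by simp
  also have "\<dots> \<le> s ^ k\<^sup>2 * s ^ (4 * k\<^sup>2 + 2 * k)"
    using fact_Suc_le[of k] power_mono[OF s2, of "k * k"]
    by (intro mult_le_mono1) (simp add: power2_eq_square)
  also have "\<dots> = s ^ (5 * k\<^sup>2 + 2 * k)" by (simp flip: power_add)
  also have "\<dots> \<le> s ^ (7 * k\<^sup>2)"
    using s1 k1 by (intro power_increasing) (auto simp: power2_eq_square)
  finally show ?thesis .
qed

section \<open>Depth-4 formulas\<close>

text \<open>Bounds the sparsity of every factor of the flattened formula, and does not depend on how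
  gates are weighted.\<close>

definition terms :: "('v, 'a) formula \<Rightarrow> nat" where
  "terms \<Phi> = (\<Sum>ts\<leftarrow>leaves \<Phi>. length ts)"

definition occurrences :: "'v \<Rightarrow> ('v, 'a::comm_ring_1) formula \<Rightarrow> nat" where
  "occurrences v \<Phi> = length (filter (\<lambda>ts. v \<in> vars (depth2_poly ts)) (leaves \<Phi>))"

definition poly_occurrences :: "'v \<Rightarrow> (('v, 'a::zero) mpoly \<times> nat) list \<Rightarrow> nat" where
  "poly_occurrences v ps = length (filter (\<lambda>(p, e). v \<in> vars p) ps)"

definition power_product :: "(('v, 'a::comm_ring_1) mpoly \<times> nat) list \<Rightarrow> ('v, 'a) mpoly" where
  "power_product ps = (\<Prod>(p, e)\<leftarrow>ps. p ^ e)"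

lemma occurrences_simps [simp]:
  "occurrences v (Leaf ts) = (if v \<in> vars (depth2_poly ts) then 1 else 0)"
  "occurrences v (SumGate gs) = (\<Sum>g\<leftarrow>gs. occurrences v g)"
  "occurrences v (PowerProductGate hs) = (\<Sum>(g, e)\<leftarrow>hs. occurrences v g)"
  by (simp_all add: occurrences_def filter_concat length_concat o_def case_prod_unfold)

lemma sum_list_map_concat: "(\<Sum>y\<leftarrow>concat (map h xs). u y) = (\<Sum>x\<leftarrow>xs. \<Sum>y\<leftarrow>h x. u y)"
  by (induction xs) simp_all

lemma terms_simps [simp]:
  "terms (Leaf ts) = length ts"
  "terms (SumGate gs) = (\<Sum>g\<leftarrow>gs. terms g)"
  "terms (PowerProductGate hs) = (\<Sum>(g, e)\<leftarrow>hs. terms g)"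
  by (simp_all add: terms_def sum_list_map_concat case_prod_unfold)

lemma poly_occurrences_concat:
  "poly_occurrences v (concat pss) = (\<Sum>ps\<leftarrow>pss. poly_occurrences v ps)"
  by (simp add: poly_occurrences_def filter_concat length_concat o_def)

lemma power_product_concat: "power_product (concat pss) = (\<Prod>ps\<leftarrow>pss. power_product ps)"
  by (induction pss) (simp_all add: power_product_def)

lemma power_product_power: "power_product (map (\<lambda>(p, e). (p, e * d)) ps) = power_product ps ^ d"
  by (induction ps) (auto simp: power_product_def power_mult power_mult_distrib)

text \<open>Each term of a leaf pays for an edge and a product gate whatever \<open>w\<close> is, so
  both size measures are covered. The factor 2 makes the size at least 2 once there is a
  term.\<close>

lemma two_terms_le_size: "2 * terms \<Phi> \<le> weighted_size w \<Phi>"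
proof (induction \<Phi>)
  case (Leaf ts)
  have "2 * length ts \<le> (\<Sum>(c, m)\<leftarrow>ts. 2 + monomial_degree m)" by (induction ts) auto
  thus ?case by (simp add: depth2_size_def)
next
  case (SumGate gs)
  hence "(\<Sum>g\<leftarrow>gs. 2 * terms g) \<le> (\<Sum>g\<leftarrow>gs. weighted_size w g)" by (intro sum_list_mono) auto
  thus ?case by (simp add: sum_list_const_mult)
next
  case (PowerProductGate hs)
  hence "(\<Sum>(g, e)\<leftarrow>hs. 2 * terms g) \<le> (\<Sum>(g, e)\<leftarrow>hs. weighted_size w g)"
    by (intro sum_list_mono) force
  thus ?case by (simp add: sum_list_const_mult case_prod_unfold)
qed

lemma sparsity_depth2_poly: "sparsity (depth2_poly ts) \<le> length ts"
proof -
  have "(\<Sum>(c, m)\<leftarrow>ts. sparsity (Poly_Mapping.single m c)) \<le> (\<Sum>t\<leftarrow>ts. 1)"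
    by (rule sum_list_mono) (use sparsity_single in \<open>auto simp: case_prod_unfold\<close>)
  hence "(\<Sum>(c, m)\<leftarrow>ts. sparsity (Poly_Mapping.single m c)) \<le> length ts"
    by (simp add: sum_list_triv)
  moreover have "sparsity (depth2_poly ts) \<le> (\<Sum>(c, m)\<leftarrow>ts. sparsity (Poly_Mapping.single m c))"
    using sparsity_sum_list[of "map (\<lambda>(c, m). Poly_Mapping.single m c) ts"]
    unfolding depth2_poly_def by (simp add: o_def case_prod_unfold)
  ultimately show ?thesis by linarith
qed

section \<open>Flattening to a sum of power products\<close>

lemma gate_layers_0: "gate_layers \<Phi> = 0 \<Longrightarrow> \<exists>ts. \<Phi> = Leaf ts"
  by (cases \<Phi>) auto

lemma gate_layers_SumGate: "gate_layers (SumGate gs) \<le> Suc d \<longleftrightarrow> (\<forall>g\<in>set gs. gate_layers g \<le> d)"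
  by simp

lemma gate_layers_PowerProductGate:
  "gate_layers (PowerProductGate hs) \<le> Suc d \<longleftrightarrow> (\<forall>(g, e)\<in>set hs. gate_layers g \<le> d)"
  by auto

lemma vars_sum_list: "v \<in> vars (\<Sum>x\<leftarrow>xs. p x) \<Longrightarrow> \<exists>x\<in>set xs. v \<in> vars (p x)"
proof (induction xs)
  case Nil
  thus ?case by (simp add: vars_def)
next
  case (Cons x xs)
  thus ?case using keys_add[of "p x" "\<Sum>x\<leftarrow>xs. p x"] unfolding vars_def by auto
qed

lemma sum_list_ge_member: "x \<in> set xs \<Longrightarrow> h x \<le> (\<Sum>x\<leftarrow>xs. h x)" for h :: "'b \<Rightarrow> nat"
  by (rule member_le_sum_list) auto

text \<open>The outer list stands for a sum, the inner ones for products of powers. Occurrences must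
  not increase, and sparsity is measured against all leaves together, since a sum of leaves may
  become one factor.\<close>

definition normal_form :: "('v, 'a::comm_ring_1) formula \<Rightarrow> (('v, 'a) mpoly \<times> nat) list list \<Rightarrow> bool" where
  "normal_form \<Phi> pss \<longleftrightarrow> computes \<Phi> = (\<Sum>ps\<leftarrow>pss. power_product ps) \<and>
     (\<forall>v. poly_occurrences v (concat pss) \<le> occurrences v \<Phi>) \<and>
     (\<forall>(p, e)\<in>set (concat pss). sparsity p \<le> terms \<Phi>)"

lemma normal_form_single:
  "normal_form \<Phi> [ps] \<longleftrightarrow> computes \<Phi> = power_product ps \<and>
     (\<forall>v. poly_occurrences v ps \<le> occurrences v \<Phi>) \<and> (\<forall>(p, e)\<in>set ps. sparsity p \<le> terms \<Phi>)"
  by (simp add: normal_form_def)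

text \<open>One product suffices: a sum of leaves is itself a sparse polynomial, in which a variable
  occurs only if it occurs in some leaf, and a product of leaves keeps them as factors.\<close>

lemma normal_form_depth3:
  assumes "gate_layers \<Phi> \<le> 1"
  shows "\<exists>ps. normal_form \<Phi> [ps]"
proof (cases \<Phi>)
  case (Leaf ts)
  have "normal_form \<Phi> [[(depth2_poly ts, 1)]]"
    unfolding normal_form_single Leaf
    by (simp add: power_product_def poly_occurrences_def sparsity_depth2_poly)
  thus ?thesis by blast
next
  case (SumGate gs)
  have leaf: "\<exists>ts. g = Leaf ts" if "g \<in> set gs" for g
    using assms that gate_layers_SumGate[of gs 0] unfolding SumGate by (intro gate_layers_0) auto
  have "normal_form \<Phi> [[(computes \<Phi>, 1)]]"
    unfolding normal_form_single
  proof (intro conjI allI)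
    show "computes \<Phi> = power_product [(computes \<Phi>, 1)]" by (simp add: power_product_def)
    fix v
    have "1 \<le> occurrences v \<Phi>" if v: "v \<in> vars (computes \<Phi>)"
    proof -
      obtain g where g: "g \<in> set gs" "v \<in> vars (computes g)"
        using vars_sum_list[of v computes gs] v unfolding SumGate by auto
      obtain ts where ts: "g = Leaf ts" using leaf[OF g(1)] by blast
      have "occurrences v g \<le> occurrences v \<Phi>"
        using sum_list_ge_member[OF g(1), of "occurrences v"] unfolding SumGate by simp
      thus ?thesis using g(2) unfolding ts by simp
    qed
    thus "poly_occurrences v [(computes \<Phi>, 1)] \<le> occurrences v \<Phi>"
      by (simp add: poly_occurrences_def)
  next
    have "sparsity (computes \<Phi>) \<le> (\<Sum>g\<leftarrow>gs. sparsity (computes g))"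
      using sparsity_sum_list[of "map computes gs"] unfolding SumGate by (simp add: o_def)
    also have "\<dots> \<le> (\<Sum>g\<leftarrow>gs. terms g)"
      by (rule sum_list_mono) (use leaf sparsity_depth2_poly in fastforce)
    finally show "\<forall>(p, e)\<in>set [(computes \<Phi>, 1)]. sparsity p \<le> terms \<Phi>" unfolding SumGate by simp
  qed
  thus ?thesis by blast
next
  case (PowerProductGate hs)
  have leaf: "\<exists>ts. g = Leaf ts" if "(g, e) \<in> set hs" for g e
    using assms that gate_layers_PowerProductGate[of hs 0] unfolding PowerProductGate
    by (intro gate_layers_0) auto
  let ?ps = "map (\<lambda>(g, e). (computes g, e)) hs"
  have "normal_form \<Phi> [?ps]"
    unfolding normal_form_single
  proof (intro conjI allI)
    show "computes \<Phi> = power_product ?ps"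
      unfolding PowerProductGate power_product_def by (simp add: o_def case_prod_unfold)
    fix v
    have "poly_occurrences v ?ps = (\<Sum>(g, e)\<leftarrow>hs. if v \<in> vars (computes g) then 1 else 0)"
      unfolding poly_occurrences_def by (induction hs) auto
    also have "\<dots> \<le> (\<Sum>(g, e)\<leftarrow>hs. occurrences v g)"
      by (rule sum_list_mono) (use leaf in fastforce)
    finally show "poly_occurrences v ?ps \<le> occurrences v \<Phi>" unfolding PowerProductGate by simp
  next
    have "sparsity (computes g) \<le> terms \<Phi>" if ge: "(g, e) \<in> set hs" for g e
    proof -
      obtain ts where "g = Leaf ts" using leaf[OF ge] by blast
      hence "sparsity (computes g) \<le> terms g" using sparsity_depth2_poly by simp
      also have "\<dots> \<le> terms \<Phi>"
        using sum_list_ge_member[OF ge, of "\<lambda>(g, e). terms g"] unfolding PowerProductGate by simp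
      finally show ?thesis .
    qed
    thus "\<forall>(p, e)\<in>set ?ps. sparsity p \<le> terms \<Phi>" by auto
  qed
  thus ?thesis by blast
qed

text \<open>An outer sum yields one product per child. An outer product multiplies its labels into
  the exponents of its children and concatenates them. Gates of the two kinds may thus be stacked in
  any order.\<close>

lemma normal_form_depth4:
  assumes "gate_layers \<Phi> \<le> 2"
  shows "\<exists>pss. normal_form \<Phi> pss"
proof (cases \<Phi>)
  case (Leaf ts)
  hence "gate_layers \<Phi> \<le> 1" by simp
  thus ?thesis using normal_form_depth3 by blast
next
  case (SumGate gs)
  have "\<forall>g\<in>set gs. \<exists>ps. normal_form g [ps]"
    using assms gate_layers_SumGate[of gs 1] normal_form_depth3 unfolding SumGate
    by (auto simp: numeral_2_eq_2)
  then obtain h where h: "\<And>g. g \<in> set gs \<Longrightarrow> normal_form g [h g]" by metis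
  have "normal_form \<Phi> (map h gs)"
    unfolding normal_form_def
  proof (intro conjI allI)
    show "computes \<Phi> = (\<Sum>ps\<leftarrow>map h gs. power_product ps)"
      using h unfolding SumGate by (auto simp: o_def normal_form_single intro!: arg_cong[of _ _ sum_list])
    show "poly_occurrences v (concat (map h gs)) \<le> occurrences v \<Phi>" for v
      using h unfolding SumGate poly_occurrences_concat
      by (auto simp: o_def normal_form_single intro!: sum_list_mono)
    have "sparsity p \<le> terms \<Phi>" if "g \<in> set gs" "(p, e) \<in> set (h g)" for g p e
    proof -
      have "sparsity p \<le> terms g" using h[OF that(1)] that(2) unfolding normal_form_single by blast
      also have "\<dots> \<le> terms \<Phi>" using sum_list_ge_member[OF that(1), of terms] unfolding SumGate by simp
      finally show ?thesis .
    qed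
    thus "\<forall>(p, e)\<in>set (concat (map h gs)). sparsity p \<le> terms \<Phi>" by auto
  qed
  thus ?thesis by blast
next
  case (PowerProductGate hs)
  have "\<forall>(g, d)\<in>set hs. \<exists>ps. normal_form g [ps]"
    using assms gate_layers_PowerProductGate[of hs 1] normal_form_depth3 unfolding PowerProductGate
    by (fastforce simp: numeral_2_eq_2)
  hence "\<forall>x\<in>set hs. \<exists>ps. normal_form (fst x) [ps]" by auto
  then obtain h where h: "\<And>x. x \<in> set hs \<Longrightarrow> normal_form (fst x) [h x]" by metis
  let ?k = "\<lambda>x. map (\<lambda>(p, e). (p, e * snd x)) (h x)"
  have occ: "poly_occurrences v (?k x) = poly_occurrences v (h x)" for v x
    unfolding poly_occurrences_def by (induction "h x") (auto simp: filter_map o_def case_prod_unfold)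
  have "normal_form \<Phi> [concat (map ?k hs)]"
    unfolding normal_form_single
  proof (intro conjI allI)
    have "power_product (?k x) = computes (fst x) ^ snd x" if "x \<in> set hs" for x
      using h[OF that] power_product_power[of "snd x" "h x"] by (simp add: normal_form_single)
    hence "(\<Prod>x\<leftarrow>hs. power_product (?k x)) = (\<Prod>x\<leftarrow>hs. computes (fst x) ^ snd x)"
      by (intro arg_cong[of _ _ prod_list] map_cong refl)
    also have "\<dots> = computes \<Phi>" unfolding PowerProductGate by (simp add: case_prod_unfold)
    finally show "computes \<Phi> = power_product (concat (map ?k hs))"
      unfolding power_product_concat map_map o_def by (rule sym)
    show "poly_occurrences v (concat (map ?k hs)) \<le> occurrences v \<Phi>" for v
    proof -
      have "(\<Sum>x\<leftarrow>hs. poly_occurrences v (?k x)) \<le> (\<Sum>x\<leftarrow>hs. occurrences v (fst x))"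
        unfolding occ using h by (intro sum_list_mono) (auto simp: normal_form_single)
      thus ?thesis unfolding PowerProductGate poly_occurrences_concat by (simp add: o_def case_prod_unfold)
    qed
    have "sparsity p \<le> terms \<Phi>" if x: "x \<in> set hs" and p: "(p, e) \<in> set (h x)" for x p e
    proof -
      have "sparsity p \<le> terms (fst x)" using h[OF x] p unfolding normal_form_single by blast
      also have "\<dots> \<le> terms \<Phi>"
        using sum_list_ge_member[OF x, of "\<lambda>x. terms (fst x)"] unfolding PowerProductGate
        by (simp add: case_prod_unfold)
      finally show ?thesis .
    qed
    thus "\<forall>(p, e)\<in>set (concat (map ?k hs)). sparsity p \<le> terms \<Phi>" by auto
  qed
  thus ?thesis by blast
qed

text \<open>Factors are indexed by position, so that equal ones are still counted separately.
  Positions with exponent 0 are dropped, as the power rule asks for positive exponents.\<close>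

lemma normal_form_indexed:
  fixes \<Phi> :: "('v, 'a::comm_ring_1) formula"
  assumes "gate_layers \<Phi> \<le> 2"
  obtains r :: nat and L :: "nat \<Rightarrow> nat set" and g e where
    "computes \<Phi> = (\<Sum>i<r. \<Prod>l\<in>L i. g i l ^ e i l)" "\<And>i. finite (L i)"
    "\<And>i l. l \<in> L i \<Longrightarrow> (1::nat) \<le> e i l"
    "\<And>i l. i < r \<Longrightarrow> l \<in> L i \<Longrightarrow> sparsity (g i l) \<le> terms \<Phi>"
    "\<And>v. (\<Sum>i<r. card {l \<in> L i. v \<in> vars (g i l)}) \<le> occurrences v \<Phi>"
proof -
  obtain pss where pss: "normal_form \<Phi> pss" using normal_form_depth4[OF assms] by blast
  define g where "g i l = fst (pss ! i ! l)" for i l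
  define e where "e i l = snd (pss ! i ! l)" for i l
  define L where "L i = {l. l < length (pss ! i) \<and> 1 \<le> e i l}" for i
  have "power_product (pss ! i) = (\<Prod>l\<in>L i. g i l ^ e i l)" for i
  proof -
    have "power_product (pss ! i) = (\<Prod>l<length (pss ! i). g i l ^ e i l)"
      unfolding power_product_def g_def e_def
      by (simp add: prod.list_conv_set_nth case_prod_unfold lessThan_atLeast0)
    also have "\<dots> = (\<Prod>l\<in>L i. g i l ^ e i l)"
      unfolding L_def by (intro prod.mono_neutral_right) (auto simp: not_less_eq_eq)
    finally show ?thesis .
  qed
  hence 1: "computes \<Phi> = (\<Sum>i<length pss. \<Prod>l\<in>L i. g i l ^ e i l)"
    using pss unfolding normal_form_def by (simp add: sum.list_conv_set_nth lessThan_atLeast0)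
  have 2: "(\<Sum>i<length pss. card {l \<in> L i. v \<in> vars (g i l)}) \<le> occurrences v \<Phi>" for v
  proof -
    have "(\<Sum>i<length pss. card {l \<in> L i. v \<in> vars (g i l)}) \<le> (\<Sum>i<length pss. poly_occurrences v (pss ! i))"
    proof (rule sum_mono)
      fix i
      have "{l \<in> L i. v \<in> vars (g i l)} \<subseteq> {l. l < length (pss ! i) \<and> (case pss ! i ! l of (p, e) \<Rightarrow> v \<in> vars p)}"
        by (auto simp: L_def g_def case_prod_unfold)
      thus "card {l \<in> L i. v \<in> vars (g i l)} \<le> poly_occurrences v (pss ! i)"
        unfolding poly_occurrences_def length_filter_conv_card by (intro card_mono) auto
    qed
    also have "\<dots> = poly_occurrences v (concat pss)"
      unfolding poly_occurrences_concat by (simp add: sum.list_conv_set_nth lessThan_atLeast0)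
    also have "\<dots> \<le> occurrences v \<Phi>" using pss unfolding normal_form_def by blast
    finally show ?thesis .
  qed
  have 3: "sparsity (g i l) \<le> terms \<Phi>" if "i < length pss" "l \<in> L i" for i l
  proof -
    have "pss ! i ! l \<in> set (concat pss)" using that by (auto simp: L_def intro!: bexI[of _ "pss ! i"])
    thus ?thesis using pss unfolding normal_form_def g_def by (auto simp: case_prod_unfold)
  qed
  show ?thesis by (rule that[OF 1 _ _ 3 2]) (auto simp: L_def)
qed

section \<open>From the flattened form to the size bound\<close>

lemma matching_poly_nonconstant:
  fixes n :: nat
  assumes "0 < n" and c: "\<And>E. E \<in> matchings {..<n} {..<n} \<Longrightarrow> c E \<noteq> 0"
  shows "\<exists>m. m \<noteq> 0 \<and> Poly_Mapping.lookup (matching_poly {..<n} {..<n} c) m \<noteq> 0"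
proof -
  have "id \<in> Sym n" by (simp add: Sym_def permutes_id)
  then obtain E0 where E0: "E0 \<in> matchings {..<n} {..<n}"
    using bij_betwE[OF bij_betw_graph_Sym] by blast
  have fin: "finite E" if "E \<in> matchings {..<n} {..<n}" for E using finite_matching[OF that] by simp
  \<comment> \<open>Distinct matchings have distinct monomials, so the term of \<open>E0\<close>
    cannot be cancelled.\<close>
  have inj: "edge_monomial E = edge_monomial E0 \<longleftrightarrow> E = E0" if "E \<in> matchings {..<n} {..<n}" for E
  proof
    assume "edge_monomial E = edge_monomial E0"
    hence "of_bool (e \<in> E) = (of_bool (e \<in> E0) :: nat)" for e
      using lookup_edge_monomial[OF fin[OF that], of e] lookup_edge_monomial[OF fin[OF E0], of e] by simp
    hence "e \<in> E \<longleftrightarrow> e \<in> E0" for e by (simp only: of_bool_eq_iff)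
    thus "E = E0" by blast
  qed simp
  have "Poly_Mapping.lookup (matching_poly {..<n} {..<n} c) (edge_monomial E0) =
      (\<Sum>E\<in>matchings {..<n} {..<n}. if E = E0 then c E else 0)"
    unfolding matching_poly_def lookup_sum
    by (intro sum.cong refl) (simp add: lookup_single when_def inj)
  also have "\<dots> = c E0" using E0 by (simp add: finite_matchings)
  finally have "Poly_Mapping.lookup (matching_poly {..<n} {..<n} c) (edge_monomial E0) \<noteq> 0"
    using c[OF E0] by simp
  moreover have "edge_monomial E0 \<noteq> 0"
  proof -
    have "card E0 = n" using matchings_card[OF E0] by simp
    hence "E0 \<noteq> {}" using assms(1) by auto
    then obtain x where "x \<in> E0" by blast
    hence "Poly_Mapping.lookup (edge_monomial E0) x = 1" using lookup_edge_monomial[OF fin[OF E0]] by simp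
    thus ?thesis by auto
  qed
  ultimately show ?thesis by blast
qed

lemma depth4_size_lower_bound:
  fixes \<Phi> :: "(nat \<times> nat, 'a::field) formula"
  assumes n: "1 \<le> n" and k: "1 \<le> k" and depth: "depth \<Phi> = 4" and occ: "occur k \<Phi>"
    and comp: "computes \<Phi> = matching_poly {..<n} {..<n} c"
    and c: "\<And>E. E \<in> matchings {..<n} {..<n} \<Longrightarrow> c E \<noteq> 0"
  shows "2 powr (1 / 14 * real n / (real k)\<^sup>2) \<le> real (weighted_size w \<Phi>)"
proof -
  let ?s = "weighted_size w \<Phi>"
  have "gate_layers \<Phi> \<le> 2" using depth by (simp add: depth_def)
  then obtain r :: nat and L :: "nat \<Rightarrow> nat set" and g e where
    f: "computes \<Phi> = (\<Sum>i<r. \<Prod>l\<in>L i. g i l ^ e i l)" and fin: "\<And>i. finite (L i)"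
    and e: "\<And>i l. l \<in> L i \<Longrightarrow> (1::nat) \<le> e i l"
    and sp: "\<And>i l. i < r \<Longrightarrow> l \<in> L i \<Longrightarrow> sparsity (g i l) \<le> terms \<Phi>"
    and oc: "\<And>v. (\<Sum>i<r. card {l \<in> L i. v \<in> vars (g i l)}) \<le> occurrences v \<Phi>"
    by (rule normal_form_indexed) blast
  \<comment> \<open>Without terms every factor is 0, so each product is 0 or empty and the formula
    computes a constant, which the matching polynomial is not.\<close>
  have "terms \<Phi> \<noteq> 0"
  proof
    assume "terms \<Phi> = 0"
    hence "g i l = 0" if "i < r" "l \<in> L i" for i l
      using sp[OF that] by (simp add: sparsity_def)
    hence "(\<Prod>l\<in>L i. g i l ^ e i l) = (if L i = {} then 1 else 0)" if "i < r" for i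
      using that e[of _ i] fin[of i] by (force simp: prod_zero_iff power_0_left intro!: prod_zero)
    hence "Poly_Mapping.lookup (computes \<Phi>) m = 0" if "m \<noteq> 0" for m
      unfolding f lookup_sum using that by (intro sum.neutral) (simp add: lookup_one)
    moreover obtain m where "m \<noteq> 0" "Poly_Mapping.lookup (computes \<Phi>) m \<noteq> 0"
      unfolding comp using matching_poly_nonconstant[of n c] c n by auto
    ultimately show False by blast
  qed
  hence s2: "2 \<le> ?s" and st: "terms \<Phi> \<le> ?s" using two_terms_le_size[of \<Phi> w] by auto
  have kpos: "0 < (real k)\<^sup>2" using k by simp
  show ?thesis
  proof (cases "10 * k \<le> n")
    \<comment> \<open>For \<open>n < 10 * k\<close> the claimed bound is at most 2.\<close>
    case False
    have "real n \<le> 10 * real k" using False by linarith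
    also have "\<dots> \<le> 14 * (real k)\<^sup>2"
      using k mult_left_mono[of 1 "real k" "real k"] by (simp add: power2_eq_square)
    finally have "1 / 14 * real n / (real k)\<^sup>2 \<le> 1" using kpos by (simp add: field_simps)
    hence "2 powr (1 / 14 * real n / (real k)\<^sup>2) \<le> 2 powr 1" by (intro powr_mono) auto
    thus ?thesis using s2 by simp
  next
    case True
    \<comment> \<open>The solution of \<open>n = Suc (2 * (k + 1) + q)\<close>; it is at least
      \<open>n / 2\<close> because \<open>10 * k \<le> n\<close>. Together with the exponent
      \<open>7 * k\<^sup>2\<close> this gives the constant \<open>1 / 14\<close>.\<close>
    define q where "q = n - (2 * k + 3)"
    have "2 ^ q \<le> ?s ^ (7 * k\<^sup>2)"
    proof (rule sum_of_products_lower_bound[of "{..<r}" L e g ?s k n c q])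
      show "sparsity (g i l) \<le> ?s" if "i \<in> {..<r}" "l \<in> L i" for i l
        using order_trans[OF sp st] that by simp
      show "(\<Sum>i<r. card {l \<in> L i. v \<in> vars (g i l)}) \<le> k" for v
        using order_trans[OF oc] occ unfolding occur_def occurrences_def by blast
      show "n = Suc (2 * (k + 1) + q)" using True k unfolding q_def by simp
      show "(\<Sum>i<r. \<Prod>l\<in>L i. g i l ^ e i l) = matching_poly {..<n} {..<n} c"
        using f comp by simp
    qed (use fin e s2 k c in auto)
    hence "real (2 ^ q) \<le> real (?s ^ (7 * k\<^sup>2))" by (rule of_nat_mono)
    hence q: "2 powr real q \<le> real ?s powr (7 * (real k)\<^sup>2)"
      using powr_realpow[of 2 q] powr_realpow[of "real ?s" "7 * k\<^sup>2"] s2 by simp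
    have "real n / 2 \<le> real q" using True k unfolding q_def by simp
    hence "2 powr (real n / 2) \<le> 2 powr real q" by (intro powr_mono) auto
    also note q
    finally have "2 powr (real n / 2) \<le> real ?s powr (7 * (real k)\<^sup>2)" .
    hence "(2 powr (real n / 2)) powr (1 / (7 * (real k)\<^sup>2)) \<le>
        (real ?s powr (7 * (real k)\<^sup>2)) powr (1 / (7 * (real k)\<^sup>2))"
      by (intro powr_mono2) auto
    thus ?thesis using kpos s2 by (simp add: powr_powr mult.commute)
  qed
qed

theorem theorem1p6:
  shows "\<exists>c::real. c > 0 \<and>
    (\<forall>(n::nat) (k::nat) (\<chi> :: (nat \<Rightarrow> nat) \<Rightarrow> complex) (K :: complex set)
       (\<phi> :: complex \<Rightarrow> 'a::field_char_0) (\<Phi> :: (nat \<times> nat, 'a) formula).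
       n \<ge> 1 \<longrightarrow> k \<ge> 1 \<longrightarrow>
       is_unit_character n \<chi> \<longrightarrow>
       field_embedding K \<phi> \<longrightarrow> \<chi> ` Sym n \<subseteq> K \<longrightarrow>
       depth \<Phi> = 4 \<longrightarrow> occur k \<Phi> \<longrightarrow>
       computes \<Phi> = generic_immanant n \<chi> \<phi> \<longrightarrow>
       real (formula_size \<Phi>) \<ge> 2 powr (c * real n / (real k)\<^sup>2) \<and>
       real (formula_size_unit \<Phi>) \<ge> 2 powr (c * real n / (real k)\<^sup>2))"
proof (intro exI[of _ "1 / 14"] conjI[of "0 < (1 / 14 :: real)"] allI impI)
  fix n k :: nat and \<chi> :: "(nat \<Rightarrow> nat) \<Rightarrow> complex" and K and \<phi> :: "complex \<Rightarrow> 'a"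
    and \<Phi> :: "(nat \<times> nat, 'a) formula"
  assume nk: "n \<ge> 1" "k \<ge> 1" and \<chi>: "is_unit_character n \<chi>"
    and \<phi>: "field_embedding K \<phi>" and K: "\<chi> ` Sym n \<subseteq> K"
    and \<Phi>: "depth \<Phi> = 4" "occur k \<Phi>" and comp: "computes \<Phi> = generic_immanant n \<chi> \<phi>"
  \<comment> \<open>\<open>K\<close> contains the inverse of the value, and \<open>\<phi>\<close>
    respects products and 1.\<close>
  have nz: "\<phi> (\<chi> \<sigma>) \<noteq> 0" if "\<sigma> \<in> Sym n" for \<sigma>
  proof -
    have "\<chi> \<sigma> \<noteq> 0" "\<chi> \<sigma> \<in> K" using \<chi> K that by (auto simp: is_unit_character_def)
    hence "\<phi> (\<chi> \<sigma>) * \<phi> (inverse (\<chi> \<sigma>)) = 1"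
      using \<phi> unfolding field_embedding_def by (metis right_inverse)
    thus ?thesis by auto
  qed
  obtain c where c: "generic_immanant n \<chi> \<phi> = matching_poly {..<n} {..<n} c"
    "\<And>E. E \<in> matchings {..<n} {..<n} \<Longrightarrow> c E \<noteq> 0"
    using generic_immanant_matching_poly[where n = n and \<phi> = \<phi> and \<chi> = \<chi>] nz by blast
  \<comment> \<open>The weight \<open>w\<close> is still free here and is chosen once for each of
    the two sizes.\<close>
  note * = depth4_size_lower_bound[OF nk \<Phi> comp[unfolded c(1)] c(2)]
  show "real (formula_size \<Phi>) \<ge> 2 powr (1 / 14 * real n / (real k)\<^sup>2) \<and>
      real (formula_size_unit \<Phi>) \<ge> 2 powr (1 / 14 * real n / (real k)\<^sup>2)"
    unfolding formula_size_def formula_size_unit_def using * by blast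
qed simp

end
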